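(* Let $(R,\mathfrak m,k)$ be a noetherian local ring (or a standard graded $k$-algebra). Let $0\to M'\xrightarrow{\phi'} P'\xrightarrow{\lambda'} N'\to 0$ be a short exact sequence of non-zero finitely generated $R$-modules (graded, with degree-preserving maps, in the graded case), where $M'$ is identified with a submodule of $P'$ via $\phi'$. Assume that (i) $M'$ is a Koszul module; (ii) $M'\cap \mathfrak m P'=\mathfrak m M'$. Then $\operatorname{ld}_R P'\le \operatorname{ld}_R N'\le \max\{\operatorname{ld}_R P',1\}$. In particular, $\operatorname{ld}_R N'=\operatorname{ld}_R P'$ if $\operatorname{ld}_R P'\ge 1$, and $\operatorname{ld}_R N'\le 1$ if $\operatorname{ld}_R P'=0$. Moreover, $\operatorname{ld}_R N'=0$ if and only if $P'$ is a Koszul module and $M'\cap \mathfrak m^sP'=\mathfrak m^sM'$ for all $s\ge 1$.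
   Context: $(R,\mathfrak m,k)$ denotes a commutative noetherian local ring with maximal ideal $\mathfrak m$ and residue field $k=R/\mathfrak m$; statements are also meant to cover, with the obvious changes, the graded situation where $R$ is a standard graded $k$-algebra with graded maximal ideal $\mathfrak m$ and modules are graded. Linearity defect: for a finitely generated $R$-module $M$ with minimal free resolution $F$, filter $F$ by the subcomplexes $\mathcal G^nF$ with $(\mathcal G^nF)_i=\mathfrak m^{n-i}F_i$ (where $\mathfrak m^j=R$ for $j\le 0$), with differential induced by that of $F$. The associated graded complex of this filtration is the linear part $\operatorname{lin}^R F$. The linearity defect is $\operatorname{ld}_R M=\sup\{i: H_i(\operatorname{lin}^R F)\ne 0\}\in\{0,1,\dots\}\cup\{\infty\}$ for $M\neq 0$, and $\operatorname{ld}_R 0=0$. $M$ is called a Koszul module if $\operatorname{ld}_R M=0$. *)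

theory Defs
  imports
    Main
    "HOL-Library.Function_Algebras"
    "HOL-Library.Set_Algebras"
    "HOL-Library.Extended_Nat"
begin

text \<open>
  The ring \<open>R\<close> is a type of class \<^class>\<open>comm_ring_1\<close>; an \<open>R\<close>-module is a scalar multiplication
  satisfying the locale \<^locale>\<open>module\<close>. Ideals are the submodules of \<open>R\<close> over itself.
\<close>

abbreviation ideal :: "'r::comm_ring_1 set \<Rightarrow> bool" where
  "ideal \<equiv> module.subspace (*)"

definition noetherian :: "'r::comm_ring_1 itself \<Rightarrow> bool" where
  "noetherian _ \<longleftrightarrow>
     (\<forall>I :: 'r set. ideal I \<longrightarrow> (\<exists>S. finite S \<and> I = module.span (*) S))"

definition maximal_ideal :: "'r::comm_ring_1 set \<Rightarrow> bool" where
  "maximal_ideal I \<longleftrightarrow>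
     ideal I \<and> I \<noteq> UNIV \<and> (\<forall>J. ideal J \<and> I \<subseteq> J \<longrightarrow> J = I \<or> J = UNIV)"

definition noetherian_local_ring :: "'r::comm_ring_1 set \<Rightarrow> bool" where
  "noetherian_local_ring m \<longleftrightarrow>
     noetherian TYPE('r) \<and> {I. maximal_ideal I} = {m}"

definition finitely_generated :: "('r::comm_ring_1 \<Rightarrow> 'm::ab_group_add \<Rightarrow> 'm) \<Rightarrow> bool" where
  "finitely_generated s \<longleftrightarrow> (\<exists>S. finite S \<and> module.span s S = UNIV)"

definition ideal_smult ::
    "('r::comm_ring_1 \<Rightarrow> 'm::ab_group_add \<Rightarrow> 'm) \<Rightarrow> 'r set \<Rightarrow> 'm set \<Rightarrow> 'm set" where
  "ideal_smult s I N = module.span s {s a x | a x. a \<in> I \<and> x \<in> N}"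

primrec ideal_power :: "'r::comm_ring_1 set \<Rightarrow> nat \<Rightarrow> 'r set" where
  "ideal_power I 0 = UNIV"
| "ideal_power I (Suc n) = ideal_smult (*) I (ideal_power I n)"

definition short_exact ::
    "('r::comm_ring_1 \<Rightarrow> 'a::ab_group_add \<Rightarrow> 'a) \<Rightarrow> ('r \<Rightarrow> 'b::ab_group_add \<Rightarrow> 'b)
      \<Rightarrow> ('r \<Rightarrow> 'c::ab_group_add \<Rightarrow> 'c) \<Rightarrow> ('a \<Rightarrow> 'b) \<Rightarrow> ('b \<Rightarrow> 'c) \<Rightarrow> bool" where
  "short_exact s1 s2 s3 f g \<longleftrightarrow>
     module_hom s1 s2 f \<and> module_hom s2 s3 g \<and> inj f \<and> range f = {x. g x = 0} \<and> surj g"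


subsection \<open>Free resolutions\<close>

text \<open>
  \<open>R\<^sup>r\<close> is realised as the set of those \<open>x :: nat \<Rightarrow> 'r\<close> that vanish outside \<open>{..<r}\<close>. A linear
  map out of \<open>R\<^sup>r\<close> is given as a linear map on all of \<open>nat \<Rightarrow> 'r\<close>, of which only the restriction
  to \<open>R\<^sup>r\<close> is used; every linear map on \<open>R\<^sup>r\<close> arises in this way, by composition with the
  truncation to the first \<open>r\<close> coordinates.
\<close>

definition vscale :: "'r::comm_ring_1 \<Rightarrow> (nat \<Rightarrow> 'r) \<Rightarrow> nat \<Rightarrow> 'r" where
  "vscale c x = (\<lambda>j. c * x j)"

definition free_mod :: "nat \<Rightarrow> (nat \<Rightarrow> 'r::comm_ring_1) set" where
  "free_mod r = {x. \<forall>j\<ge>r. x j = 0}"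

text \<open>
  A resolution \<open>\<dots> \<rightarrow> F\<^sub>2 \<rightarrow> F\<^sub>1 \<rightarrow> F\<^sub>0 \<rightarrow> M \<rightarrow> 0\<close> by finitely generated free modules is given by the
  ranks \<open>b i\<close> of the \<open>F\<^sub>i = free_mod (b i)\<close>, the differentials \<open>d i : F\<^sub>i \<rightarrow> F\<^sub>i\<^sub>-\<^sub>1\<close> for \<open>i \<ge> 1\<close> and
  the augmentation \<open>e : F\<^sub>0 \<rightarrow> M\<close>. The map \<open>d 0\<close> plays no role, since \<open>F\<^sub>-\<^sub>1 = 0\<close>.
\<close>

definition free_resolution ::
    "('r::comm_ring_1 \<Rightarrow> 'm::ab_group_add \<Rightarrow> 'm) \<Rightarrow> (nat \<Rightarrow> nat)
      \<Rightarrow> (nat \<Rightarrow> (nat \<Rightarrow> 'r) \<Rightarrow> nat \<Rightarrow> 'r) \<Rightarrow> ((nat \<Rightarrow> 'r) \<Rightarrow> 'm) \<Rightarrow> bool" where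
  "free_resolution s b d e \<longleftrightarrow>
     (\<forall>i\<ge>1. module_hom vscale vscale (d i) \<and> d i ` free_mod (b i) \<subseteq> free_mod (b (i - 1))) \<and>
     module_hom vscale s e \<and>
     e ` free_mod (b 0) = UNIV \<and>
     d 1 ` free_mod (b 1) = {x \<in> free_mod (b 0). e x = 0} \<and>
     (\<forall>i\<ge>1. d (Suc i) ` free_mod (b (Suc i)) = {x \<in> free_mod (b i). d i x = 0})"

definition minimal_free_resolution ::
    "'r set \<Rightarrow> ('r::comm_ring_1 \<Rightarrow> 'm::ab_group_add \<Rightarrow> 'm) \<Rightarrow> (nat \<Rightarrow> nat)
      \<Rightarrow> (nat \<Rightarrow> (nat \<Rightarrow> 'r) \<Rightarrow> nat \<Rightarrow> 'r) \<Rightarrow> ((nat \<Rightarrow> 'r) \<Rightarrow> 'm) \<Rightarrow> bool" where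
  "minimal_free_resolution m s b d e \<longleftrightarrow>
     free_resolution s b d e \<and>
     (\<forall>i\<ge>1. d i ` free_mod (b i) \<subseteq> ideal_smult vscale m (free_mod (b (i - 1))))"


subsection \<open>The linear part and the linearity defect\<close>

text \<open>
  Truncated subtraction gives \<open>m\<^sup>j = R\<close> for \<open>j \<le> 0\<close>. Filtration indices \<open>n < 0\<close> are omitted: they
  contribute nothing to the associated graded complex.
\<close>

definition lin_filtration :: "'r::comm_ring_1 set \<Rightarrow> (nat \<Rightarrow> nat) \<Rightarrow> nat \<Rightarrow> nat \<Rightarrow> (nat \<Rightarrow> 'r) set" where
  "lin_filtration m b n i = ideal_smult vscale (ideal_power m (n - i)) (free_mod (b i))"

text \<open>
  The component of filtration degree \<open>n\<close> and homological degree \<open>i\<close> of the linear part, that is, the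
  set of cosets forming the quotient of \<open>lin_filtration m b n i\<close> by \<open>lin_filtration m b (n + 1) i\<close>;
  the zero of this quotient is \<open>lin_filtration m b (n + 1) i\<close> itself.
\<close>

definition lin_part :: "'r::comm_ring_1 set \<Rightarrow> (nat \<Rightarrow> nat) \<Rightarrow> nat \<Rightarrow> nat \<Rightarrow> (nat \<Rightarrow> 'r) set set" where
  "lin_part m b n i = {x +o lin_filtration m b (n + 1) i | x. x \<in> lin_filtration m b n i}"

text \<open>
  The induced differential, for \<open>i \<ge> 1\<close>: the coset of \<open>x\<close> is sent to the coset of \<open>d i x\<close>.
\<close>

definition lin_diff ::
    "'r::comm_ring_1 set \<Rightarrow> (nat \<Rightarrow> nat) \<Rightarrow> (nat \<Rightarrow> (nat \<Rightarrow> 'r) \<Rightarrow> nat \<Rightarrow> 'r) \<Rightarrow> nat \<Rightarrow> nat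
      \<Rightarrow> (nat \<Rightarrow> 'r) set \<Rightarrow> (nat \<Rightarrow> 'r) set" where
  "lin_diff m b d n i C = d i ` C + lin_filtration m b (n + 1) (i - 1)"

definition lin_cycles ::
    "'r::comm_ring_1 set \<Rightarrow> (nat \<Rightarrow> nat) \<Rightarrow> (nat \<Rightarrow> (nat \<Rightarrow> 'r) \<Rightarrow> nat \<Rightarrow> 'r) \<Rightarrow> nat \<Rightarrow> nat
      \<Rightarrow> (nat \<Rightarrow> 'r) set set" where
  "lin_cycles m b d n i =
     {C \<in> lin_part m b n i. i \<ge> 1 \<longrightarrow> lin_diff m b d n i C = lin_filtration m b (n + 1) (i - 1)}"

definition lin_boundaries ::
    "'r::comm_ring_1 set \<Rightarrow> (nat \<Rightarrow> nat) \<Rightarrow> (nat \<Rightarrow> (nat \<Rightarrow> 'r) \<Rightarrow> nat \<Rightarrow> 'r) \<Rightarrow> nat \<Rightarrow> nat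
      \<Rightarrow> (nat \<Rightarrow> 'r) set set" where
  "lin_boundaries m b d n i = lin_diff m b d n (Suc i) ` lin_part m b n (Suc i)"

text \<open>
  The linear part is the direct sum over \<open>n\<close> of these complexes, so its \<open>i\<close>-th homology is nonzero
  iff that of some summand is.
\<close>

definition lin_homology_nonzero ::
    "'r::comm_ring_1 set \<Rightarrow> (nat \<Rightarrow> nat) \<Rightarrow> (nat \<Rightarrow> (nat \<Rightarrow> 'r) \<Rightarrow> nat \<Rightarrow> 'r) \<Rightarrow> nat \<Rightarrow> bool" where
  "lin_homology_nonzero m b d i \<longleftrightarrow> (\<exists>n. lin_cycles m b d n i \<noteq> lin_boundaries m b d n i)"

text \<open>
  In \<^typ>\<open>enat\<close> the supremum of the empty set is \<open>0\<close>, so the zero module gets linearity defect \<open>0\<close>.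
\<close>

definition lin_sup ::
    "'r::comm_ring_1 set \<Rightarrow> (nat \<Rightarrow> nat) \<Rightarrow> (nat \<Rightarrow> (nat \<Rightarrow> 'r) \<Rightarrow> nat \<Rightarrow> 'r) \<Rightarrow> enat" where
  "lin_sup m b d = Sup {enat i | i. lin_homology_nonzero m b d i}"

text \<open>
  Minimal free resolutions of a finitely generated module over a noetherian local ring exist and are
  unique up to isomorphism, so the value chosen here exists and is unique.
\<close>

definition linearity_defect ::
    "'r set \<Rightarrow> ('r::comm_ring_1 \<Rightarrow> 'm::ab_group_add \<Rightarrow> 'm) \<Rightarrow> enat" where
  "linearity_defect m s = (SOME l. \<exists>b d e. minimal_free_resolution m s b d e \<and> l = lin_sup m b d)"

definition koszul_module :: "'r set \<Rightarrow> ('r::comm_ring_1 \<Rightarrow> 'm::ab_group_add \<Rightarrow> 'm) \<Rightarrow> bool" where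
  "koszul_module m s \<longleftrightarrow> linearity_defect m s = 0"


subsection \<open>The graded situation\<close>

text \<open>All gradings are indexed by \<^typ>\<open>int\<close>; a standard graded algebra is zero in negative degrees.\<close>

definition grading :: "(int \<Rightarrow> 'm::ab_group_add set) \<Rightarrow> bool" where
  "grading G \<longleftrightarrow>
     (\<forall>n. 0 \<in> G n \<and> (\<forall>x\<in>G n. \<forall>y\<in>G n. x - y \<in> G n)) \<and>
     (\<forall>x. \<exists>!f. (\<forall>n. f n \<in> G n) \<and> finite {n. f n \<noteq> 0} \<and> x = (\<Sum>n | f n \<noteq> 0. f n))"

text \<open>
  The field \<open>k\<close> is the degree zero component \<open>A 0\<close>. The set in the last clause is the subalgebra
  generated by \<open>X\<close> over \<open>A 0\<close>.
\<close>

definition standard_graded_algebra :: "(int \<Rightarrow> 'r::comm_ring_1 set) \<Rightarrow> bool" where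
  "standard_graded_algebra A \<longleftrightarrow>
     grading A \<and>
     (\<forall>i j. \<forall>a\<in>A i. \<forall>c\<in>A j. a * c \<in> A (i + j)) \<and>
     (\<forall>i<0. A i = {0}) \<and>
     1 \<in> A 0 \<and>
     (\<forall>a\<in>A 0. a \<noteq> 0 \<longrightarrow> (\<exists>c\<in>A 0. a * c = 1)) \<and>
     (\<exists>X. finite X \<and> X \<subseteq> A 1 \<and>
        (\<lambda>S. \<forall>x\<in>S. \<forall>y\<in>S. x + y \<in> S \<and> x * y \<in> S) hull (A 0 \<union> X) = UNIV)"

definition irrelevant_ideal :: "(int \<Rightarrow> 'r::comm_ring_1 set) \<Rightarrow> 'r set" where
  "irrelevant_ideal A = module.span (*) (\<Union>i\<in>{0<..}. A i)"

definition graded_module ::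
    "(int \<Rightarrow> 'r set) \<Rightarrow> ('r::comm_ring_1 \<Rightarrow> 'm::ab_group_add \<Rightarrow> 'm) \<Rightarrow> (int \<Rightarrow> 'm set) \<Rightarrow> bool" where
  "graded_module A s G \<longleftrightarrow>
     module s \<and> grading G \<and> (\<forall>i j. \<forall>a\<in>A i. \<forall>x\<in>G j. s a x \<in> G (i + j))"

definition degree_preserving :: "(int \<Rightarrow> 'm set) \<Rightarrow> (int \<Rightarrow> 'n set) \<Rightarrow> ('m \<Rightarrow> 'n) \<Rightarrow> bool" where
  "degree_preserving G H f \<longleftrightarrow> (\<forall>n. f ` G n \<subseteq> H n)"

text \<open>
  The grading on \<open>R\<^sup>r\<close> for which the \<open>j\<close>-th basis vector has degree \<open>t j\<close>, i.e. the direct sum of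
  the twists \<open>R(- t j)\<close>.
\<close>

definition free_grading ::
    "(int \<Rightarrow> 'r::comm_ring_1 set) \<Rightarrow> nat \<Rightarrow> (nat \<Rightarrow> int) \<Rightarrow> int \<Rightarrow> (nat \<Rightarrow> 'r) set" where
  "free_grading A r t n = {x \<in> free_mod r. \<forall>j<r. x j \<in> A (n - t j)}"

definition minimal_graded_free_resolution ::
    "(int \<Rightarrow> 'r set) \<Rightarrow> ('r::comm_ring_1 \<Rightarrow> 'm::ab_group_add \<Rightarrow> 'm) \<Rightarrow> (int \<Rightarrow> 'm set)
      \<Rightarrow> (nat \<Rightarrow> nat) \<Rightarrow> (nat \<Rightarrow> nat \<Rightarrow> int)
      \<Rightarrow> (nat \<Rightarrow> (nat \<Rightarrow> 'r) \<Rightarrow> nat \<Rightarrow> 'r) \<Rightarrow> ((nat \<Rightarrow> 'r) \<Rightarrow> 'm) \<Rightarrow> bool" where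
  "minimal_graded_free_resolution A s G b t d e \<longleftrightarrow>
     minimal_free_resolution (irrelevant_ideal A) s b d e \<and>
     (\<forall>i\<ge>1. degree_preserving
        (free_grading A (b i) (t i)) (free_grading A (b (i - 1)) (t (i - 1))) (d i)) \<and>
     degree_preserving (free_grading A (b 0) (t 0)) G e"

definition graded_linearity_defect ::
    "(int \<Rightarrow> 'r set) \<Rightarrow> ('r::comm_ring_1 \<Rightarrow> 'm::ab_group_add \<Rightarrow> 'm) \<Rightarrow> (int \<Rightarrow> 'm set) \<Rightarrow> enat" where
  "graded_linearity_defect A s G =
     (SOME l. \<exists>b t d e. minimal_graded_free_resolution A s G b t d e \<and>
        l = lin_sup (irrelevant_ideal A) b d)"

definition graded_koszul_module ::
    "(int \<Rightarrow> 'r set) \<Rightarrow> ('r::comm_ring_1 \<Rightarrow> 'm::ab_group_add \<Rightarrow> 'm) \<Rightarrow> (int \<Rightarrow> 'm set) \<Rightarrow> bool" where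
  "graded_koszul_module A s G \<longleftrightarrow> graded_linearity_defect A s G = 0"

end

theory Submission
  imports Defs "HOL-Computational_Algebra.Polynomial"
begin

text \<open>
  Let \<open>F\<close> and \<open>H\<close> be minimal free resolutions of \<open>M\<close> and \<open>N\<close>, in an exact sequence \<open>0 \<rightarrow> M \<rightarrow> P \<rightarrow> N \<rightarrow> 0\<close>. The
  horseshoe construction resolves \<open>P\<close> by \<open>G\<^sub>i = F\<^sub>i \<oplus> H\<^sub>i\<close> with \<open>d (f, h) = (d f + \<theta> h, d h)\<close>. The point of the
  proof is that \<open>G\<close> is again minimal, that is, \<open>\<theta> h \<in> mF\<close> (\<open>theta_minimal\<close>, \<open>horseshoe\<close>). At the bottom this
  follows from \<open>M \<inter> mP = mM\<close>. Above, \<open>d \<theta> = - \<theta> d\<close> and minimality of \<open>H\<close> give \<open>d (\<theta> h) \<in> m\<^sup>2F\<close>, and as \<open>M\<close> is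
  Koszul the linear part of \<open>F\<close> is exact there, which forces \<open>\<theta> h \<in> mF\<close>.

  The filtration of \<open>G\<close> is the direct sum of those of \<open>F\<close> and \<open>H\<close>, so minimality of \<open>\<theta>\<close> yields an exact sequence
  \<open>0 \<rightarrow> lin F \<rightarrow> lin G \<rightarrow> lin H \<rightarrow> 0\<close> of complexes. The homology of \<open>lin F\<close> is concentrated in degree 0, where it is
  the associated graded module \<open>gr M\<close>. Hence \<open>lin G\<close> and \<open>lin H\<close> have the same homology in degrees \<open>\<ge> 2\<close>, while
  \<open>0 \<rightarrow> H\<^sub>1(lin G) \<rightarrow> H\<^sub>1(lin H) \<rightarrow> gr M \<rightarrow> H\<^sub>0(lin G)\<close> is exact. The inequalities follow at once. If \<open>P\<close> is Koszul then
  \<open>H\<^sub>0(lin G) = gr P\<close>, so \<open>H\<^sub>1(lin H)\<close> is the kernel of \<open>gr M \<rightarrow> gr P\<close>, and this map is injective exactly when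
  \<open>M \<inter> m\<^sup>sP = m\<^sup>sM\<close> for all \<open>s\<close> (\<open>lin_sup_of_extension\<close>). All of this is carried out with vectors instead of cosets,
  by means of the elementwise exactness condition \<open>lin_acyclic\<close>.

  The resolution \<open>G\<close> need not be the one by which the linearity defect of \<open>P\<close> is computed. Comparison maps between
  two minimal resolutions compose to maps homotopic to the identity, and a null-homotopic map \<open>dh + hd\<close> is
  zero on linear parts because \<open>d\<close> raises the \<open>m\<close>-adic order; so the linear parts are isomorphic
  (\<open>lin_sup_unique\<close>).

  The arguments so far apply to an ideal \<open>m\<close> of a commutative ring. Local and graded rings enter through the existence
  of minimal resolutions: the kernels are finitely generated, since the ring is noetherian (in the graded case by
  Hilbert's basis theorem), and a relation between irredundant (homogeneous) generators has all its coefficients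
  in \<open>m\<close>, since a coefficient outside \<open>m\<close>, or its component of degree 0, would be a unit.
\<close>

section \<open>Linear algebra over free modules\<close>

interpretation ring: module "(*) :: 'r::comm_ring_1 \<Rightarrow> 'r \<Rightarrow> 'r"
  by unfold_locales (simp_all add: distrib_left distrib_right mult.assoc)

text \<open>As a rewrite rule this would undo \<open>mult.assoc\<close>.\<close>

declare ring.scale_scale [simp del]

lemma module_vscale: "module (vscale :: 'r::comm_ring_1 \<Rightarrow> (nat \<Rightarrow> 'r) \<Rightarrow> nat \<Rightarrow> 'r)"
  by (rule module.intro) (simp_all add: vscale_def fun_eq_iff distrib_left distrib_right mult.assoc)

interpretation vec: module "vscale :: 'r::comm_ring_1 \<Rightarrow> (nat \<Rightarrow> 'r) \<Rightarrow> nat \<Rightarrow> 'r"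
  by (rule module_vscale)

interpretation vec_pair: module_pair
  "vscale :: 'r::comm_ring_1 \<Rightarrow> (nat \<Rightarrow> 'r) \<Rightarrow> nat \<Rightarrow> 'r" "vscale :: 'r \<Rightarrow> (nat \<Rightarrow> 'r) \<Rightarrow> nat \<Rightarrow> 'r" ..

definition unit_vec :: "nat \<Rightarrow> nat \<Rightarrow> 'r::comm_ring_1" where
  "unit_vec j = (\<lambda>k. if k = j then 1 else 0)"

lemma unit_vec_free: "j < r \<Longrightarrow> unit_vec j \<in> free_mod r"
  by (auto simp: unit_vec_def free_mod_def)

lemma subspace_free_mod: "vec.subspace (free_mod r)"
  by (auto simp: vec.subspace_def free_mod_def vscale_def)

lemma sum_fun_apply: "(\<Sum>j\<in>S. f j) k = (\<Sum>j\<in>S. f j k)"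
  for f :: "'i \<Rightarrow> 'k \<Rightarrow> 'v::comm_monoid_add"
  by (induction S rule: infinite_finite_induct) auto

lemma free_mod_expand:
  assumes "x \<in> free_mod r"
  shows "x = (\<Sum>j<r. vscale (x j) (unit_vec j))"
proof
  fix k
  have "(\<Sum>j<r. vscale (x j) (unit_vec j)) k = (\<Sum>j<r. if k = j then x j else 0)"
    unfolding sum_fun_apply by (intro sum.cong) (auto simp: vscale_def unit_vec_def)
  then show "x k = (\<Sum>j<r. vscale (x j) (unit_vec j)) k"
    using assms by (simp add: free_mod_def)
qed

lemma module_hom_expand:
  assumes "module_hom vscale s f" "x \<in> free_mod r"
  shows "f x = (\<Sum>j<r. s (x j) (f (unit_vec j)))"
proof -
  interpret f: module_hom vscale s f by fact
  show ?thesis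
    by (subst free_mod_expand[OF assms(2)]) (simp add: f.sum f.scale)
qed

definition lin_comb :: "('r::comm_ring_1 \<Rightarrow> 'm::ab_group_add \<Rightarrow> 'm) \<Rightarrow> nat \<Rightarrow> (nat \<Rightarrow> 'm)
    \<Rightarrow> (nat \<Rightarrow> 'r) \<Rightarrow> 'm" where
  "lin_comb s r c x = (\<Sum>j<r. s (x j) (c j))"

lemma module_hom_lin_comb:
  assumes "module s"
  shows "module_hom vscale s (lin_comb s r c)"
proof -
  interpret module s by fact
  show ?thesis
    by unfold_locales
       (auto simp: lin_comb_def vscale_def scale_left_distrib sum.distrib scale_sum_right)
qed

lemma lin_comb_unit:
  assumes "module s" "j < r"
  shows "lin_comb s r c (unit_vec j) = c j"
proof -
  interpret module s by fact
  have "lin_comb s r c (unit_vec j) = (\<Sum>i<r. if i = j then c j else 0)"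
    unfolding lin_comb_def by (intro sum.cong) (auto simp: unit_vec_def)
  then show ?thesis using assms by simp
qed

lemma lin_comb_image:
  assumes "module s"
  shows "lin_comb s r c ` free_mod r = module.span s (c ` {..<r})"
proof -
  interpret module s by fact
  interpret h: module_hom vscale s "lin_comb s r c" by (rule module_hom_lin_comb) fact
  have sub: "subspace (lin_comb s r c ` free_mod r)"
    by (rule h.subspace_image[OF subspace_free_mod])
  show ?thesis
  proof
    show "lin_comb s r c ` free_mod r \<subseteq> span (c ` {..<r})"
      unfolding lin_comb_def by (intro image_subsetI span_sum span_scale span_base) auto
    show "span (c ` {..<r}) \<subseteq> lin_comb s r c ` free_mod r"
    proof (rule span_minimal[OF _ sub], safe)
      fix j assume "j < r"
      then show "c j \<in> lin_comb s r c ` free_mod r"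
        using lin_comb_unit[OF assms] unit_vec_free by (metis imageI)
    qed
  qed
qed

text \<open>Projectivity of free modules.\<close>

lemma free_mod_lift:
  assumes u: "module_hom vscale t u" and v: "module_hom s t v" and V: "module.subspace s V"
    and sub: "\<And>j. j < r \<Longrightarrow> u (unit_vec j) \<in> v ` V"
  obtains h where "module_hom vscale s h" "\<And>x. h x \<in> V" "\<And>x. x \<in> free_mod r \<Longrightarrow> v (h x) = u x"
proof -
  interpret u: module_hom vscale t u by fact
  interpret v: module_hom s t v by fact
  have "\<forall>j. \<exists>y. j < r \<longrightarrow> y \<in> V \<and> v y = u (unit_vec j)"
    using sub by (auto simp: image_iff eq_commute)
  then obtain c where c: "\<And>j. j < r \<Longrightarrow> c j \<in> V \<and> v (c j) = u (unit_vec j)"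
    by metis
  show thesis
  proof
    show "module_hom vscale s (lin_comb s r c)"
      by (rule module_hom_lin_comb[OF v.m1.module_axioms])
    show "lin_comb s r c x \<in> V" for x
      unfolding lin_comb_def using c by (intro v.m1.subspace_sum v.m1.subspace_scale V) auto
    show "v (lin_comb s r c x) = u x" if "x \<in> free_mod r" for x
      unfolding lin_comb_def v.sum v.scale module_hom_expand[OF u that]
      by (intro sum.cong) (use c in auto)
  qed
qed

section \<open>Powers of an ideal\<close>

lemma subspace_ideal_smult:
  assumes "module s" shows "module.subspace s (ideal_smult s I N)"
proof -
  interpret module s by fact
  show ?thesis by (simp add: ideal_smult_def)
qed

lemma ideal_smult_base:
  assumes "module s" "a \<in> I" "x \<in> N" shows "s a x \<in> ideal_smult s I N"
proof -
  interpret module s by fact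
  show ?thesis unfolding ideal_smult_def by (rule span_base) (use assms in auto)
qed

lemma ideal_smult_minimal:
  assumes "module s" "module.subspace s V" "\<And>a x. a \<in> I \<Longrightarrow> x \<in> N \<Longrightarrow> s a x \<in> V"
  shows "ideal_smult s I N \<subseteq> V"
proof -
  interpret module s by fact
  show ?thesis unfolding ideal_smult_def by (rule span_minimal) (use assms in auto)
qed

lemma ideal_power_ideal: "ideal (ideal_power m n)"
  by (cases n) (auto intro: subspace_ideal_smult ring.module_axioms)

lemma ideal_power_SucI: "a \<in> m \<Longrightarrow> c \<in> ideal_power m n \<Longrightarrow> c * a \<in> ideal_power m (Suc n)"
  using ideal_smult_base[OF ring.module_axioms, of a m c "ideal_power m n"]
  by (simp add: mult.commute)

lemma ideal_power_1:
  assumes m: "ideal m"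
  shows "ideal_power m (Suc 0) = m"
proof
  have "a * x \<in> m" if "a \<in> m" for a x
    using ring.subspace_scale[OF m that, of x] by (simp add: mult.commute)
  then show "ideal_power m (Suc 0) \<subseteq> m"
    unfolding ideal_power.simps by (intro ideal_smult_minimal[OF ring.module_axioms m])
  show "m \<subseteq> ideal_power m (Suc 0)"
    using ideal_power_SucI[of _ m 1 0] by auto
qed

lemma ideal_power_Suc_subset: "ideal_power m (Suc n) \<subseteq> ideal_power m n"
  unfolding ideal_power.simps
  by (rule ideal_smult_minimal[OF ring.module_axioms ideal_power_ideal])
     (rule ring.subspace_scale[OF ideal_power_ideal])

lemma ideal_power_antimono: "i \<le> n \<Longrightarrow> ideal_power m n \<subseteq> ideal_power m i"
  using lift_Suc_antimono_le[of "ideal_power m" i n] ideal_power_Suc_subset by blast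

text \<open>Powers stay folded from here on, so that facts about the filtration apply syntactically.\<close>

declare ideal_power.simps(2) [simp del]

definition ideal_free :: "'r::comm_ring_1 set \<Rightarrow> nat \<Rightarrow> (nat \<Rightarrow> 'r) set" where
  "ideal_free I r = {x \<in> free_mod r. \<forall>j. x j \<in> I}"

lemma subspace_ideal_free: "ideal I \<Longrightarrow> vec.subspace (ideal_free I r)"
  by (auto simp: vec.subspace_def ring.subspace_def ideal_free_def free_mod_def vscale_def)

text \<open>The filtration of a free module is a condition on coordinates; all later computations use this form.\<close>

lemma ideal_smult_free_mod:
  assumes I: "ideal I"
  shows "ideal_smult vscale I (free_mod r) = ideal_free I r"
proof
  show "ideal_smult vscale I (free_mod r) \<subseteq> ideal_free I r"
    using ring.subspace_scale[OF I]
    by (intro ideal_smult_minimal[OF vec.module_axioms subspace_ideal_free[OF I]])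
       (auto simp: ideal_free_def free_mod_def vscale_def mult.commute)
  show "ideal_free I r \<subseteq> ideal_smult vscale I (free_mod r)"
  proof
    fix x assume x: "x \<in> ideal_free I r"
    then have "x = (\<Sum>j<r. vscale (x j) (unit_vec j))"
      by (intro free_mod_expand) (simp add: ideal_free_def)
    also have "\<dots> \<in> ideal_smult vscale I (free_mod r)"
      using x by (intro vec.subspace_sum[OF subspace_ideal_smult[OF vec.module_axioms]]
          ideal_smult_base[OF vec.module_axioms] unit_vec_free) (auto simp: ideal_free_def)
    finally show "x \<in> ideal_smult vscale I (free_mod r)" .
  qed
qed

text \<open>A linear map out of a free module carries the vectors with coordinates in \<open>I\<close> onto \<open>I\<close> times
  its image.\<close>

lemma image_ideal_free:
  assumes f: "module_hom vscale s f" and I: "ideal I"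
  shows "f ` ideal_free I r = ideal_smult s I (f ` free_mod r)"
proof -
  interpret f: module_hom vscale s f by fact
  have "f ` ideal_free I r = f ` vec.span {vscale a x |a x. a \<in> I \<and> x \<in> free_mod r}"
    by (simp add: ideal_smult_free_mod[OF I, symmetric] ideal_smult_def)
  also have "\<dots> = f.m2.span (f ` {vscale a x |a x. a \<in> I \<and> x \<in> free_mod r})"
    by (rule f.span_image[symmetric])
  also have "f ` {vscale a x |a x. a \<in> I \<and> x \<in> free_mod r} = {s a y |a y. a \<in> I \<and> y \<in> f ` free_mod r}"
    by (force simp: f.scale)
  finally show ?thesis by (simp add: ideal_smult_def)
qed

lemma ideal_smult_image:
  assumes f: "module_hom s t f"
  shows "ideal_smult t I (f ` N) = f ` ideal_smult s I N"
proof -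
  interpret f: module_hom s t f by fact
  have "f ` {s a x |a x. a \<in> I \<and> x \<in> N} = {t a y |a y. a \<in> I \<and> y \<in> f ` N}"
    by (force simp: f.scale)
  then show ?thesis using f.span_image[of "{s a x |a x. a \<in> I \<and> x \<in> N}"]
    by (simp add: ideal_smult_def)
qed

lemma ideal_free_UNIV: "ideal_free (ideal_power m 0) r = free_mod r"
  by (simp add: ideal_free_def)

lemma ideal_free_antimono: "i \<le> n \<Longrightarrow> ideal_free (ideal_power m n) r \<subseteq> ideal_free (ideal_power m i) r"
  using ideal_power_antimono[of i n m] by (auto simp: ideal_free_def)

text \<open>Any linear map between free modules preserves the \<open>m\<close>-adic filtrations; one with entries in \<open>m\<close>, such as a
  minimal differential, shifts them by one step.\<close>

lemma ideal_free_map: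
  assumes f: "module_hom vscale vscale f" "f ` free_mod r \<subseteq> free_mod t"
    and x: "x \<in> ideal_free (ideal_power m n) r"
  shows "f x \<in> ideal_free (ideal_power m n) t"
proof -
  have "f x \<in> ideal_smult vscale (ideal_power m n) (f ` free_mod r)"
    using x image_ideal_free[OF f(1) ideal_power_ideal] by blast
  also have "\<dots> \<subseteq> ideal_smult vscale (ideal_power m n) (free_mod t)"
    using f(2) unfolding ideal_smult_def by (intro vec.span_mono) blast
  finally show ?thesis by (simp add: ideal_smult_free_mod ideal_power_ideal)
qed

lemma ideal_free_minimal_map:
  assumes f: "module_hom vscale vscale f" "f ` free_mod r \<subseteq> ideal_free m t"
    and x: "x \<in> ideal_free (ideal_power m n) r"
  shows "f x \<in> ideal_free (ideal_power m (Suc n)) t"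
proof -
  have "f x \<in> ideal_smult vscale (ideal_power m n) (f ` free_mod r)"
    using x image_ideal_free[OF f(1) ideal_power_ideal] by blast
  also have "\<dots> \<subseteq> ideal_free (ideal_power m (Suc n)) t"
  proof (rule ideal_smult_minimal[OF vec.module_axioms subspace_ideal_free[OF ideal_power_ideal]])
    fix a y assume "a \<in> ideal_power m n" "y \<in> f ` free_mod r"
    with f(2) have "y \<in> ideal_free m t" and a: "a \<in> ideal_power m n"
      by auto
    then show "vscale a y \<in> ideal_free (ideal_power m (Suc n)) t"
      using ideal_power_SucI[OF _ a] by (simp add: ideal_free_def free_mod_def vscale_def)
  qed
  finally show ?thesis .
qed

section \<open>The linear part of a minimal resolution\<close>

text \<open>Exactness of the linear part at homological position \<open>i + 1\<close>, unwound: a vector of \<open>m\<^sup>jF\<^sub>i\<^sub>+\<^sub>1\<close> represents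
  a cycle when its differential drops one step deeper than minimality forces. For \<open>j = 0\<close> the truncated
  \<open>j - 1\<close> allows any \<open>z\<close>, but then minimality puts \<open>d z\<close> into \<open>mF\<^sub>i\<^sub>+\<^sub>1\<close>, so the condition says that \<open>x\<close>
  itself lies there.\<close>

definition lin_acyclic :: "'r::comm_ring_1 set \<Rightarrow> (nat \<Rightarrow> nat)
    \<Rightarrow> (nat \<Rightarrow> (nat \<Rightarrow> 'r) \<Rightarrow> nat \<Rightarrow> 'r) \<Rightarrow> nat \<Rightarrow> bool" where
  "lin_acyclic m b d i \<longleftrightarrow>
     (\<forall>j. \<forall>x \<in> ideal_free (ideal_power m j) (b (Suc i)).
        d (Suc i) x \<in> ideal_free (ideal_power m (j + 2)) (b i) \<longrightarrow>
        (\<exists>z \<in> ideal_free (ideal_power m (j - 1)) (b (Suc (Suc i))).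
           x - d (Suc (Suc i)) z \<in> ideal_free (ideal_power m (Suc j)) (b (Suc i))))"

locale min_res =
  fixes m :: "'r::comm_ring_1 set" and s :: "'r \<Rightarrow> 'm::ab_group_add \<Rightarrow> 'm"
    and b :: "nat \<Rightarrow> nat" and d :: "nat \<Rightarrow> (nat \<Rightarrow> 'r) \<Rightarrow> nat \<Rightarrow> 'r" and e :: "(nat \<Rightarrow> 'r) \<Rightarrow> 'm"
  assumes ideal_m: "ideal m"
    and resolution: "minimal_free_resolution m s b d e"
begin

abbreviation F :: "nat \<Rightarrow> nat \<Rightarrow> (nat \<Rightarrow> 'r) set" where
  "F j i \<equiv> ideal_free (ideal_power m j) (b i)"

lemma res: "free_resolution s b d e"
  using resolution by (simp add: minimal_free_resolution_def)

lemma d_hom: "module_hom vscale vscale (d (Suc i))"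
  using res by (simp add: free_resolution_def)

lemma e_hom: "module_hom vscale s e"
  using res by (simp add: free_resolution_def)

sublocale D: module_hom vscale vscale "d (Suc i)" for i
  by (rule d_hom)

sublocale E: module_hom vscale s e
  by (rule e_hom)

lemma d_minimal: "d (Suc i) ` free_mod (b (Suc i)) \<subseteq> ideal_free m (b i)"
proof -
  have "d (Suc i) ` free_mod (b (Suc i)) \<subseteq> ideal_smult vscale m (free_mod (b (Suc i - 1)))"
    using resolution[unfolded minimal_free_resolution_def, THEN conjunct2, rule_format, of "Suc i"]
    by simp
  then show ?thesis by (simp add: ideal_smult_free_mod[OF ideal_m])
qed

lemma d_free: "x \<in> free_mod (b (Suc i)) \<Longrightarrow> d (Suc i) x \<in> free_mod (b i)"
  using d_minimal[of i] by (auto simp: ideal_free_def)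

lemma d_filt: "x \<in> F j (Suc i) \<Longrightarrow> d (Suc i) x \<in> F (Suc j) i"
  by (rule ideal_free_minimal_map[OF d_hom d_minimal])

lemma e_surj: "e ` free_mod (b 0) = UNIV"
  and d_image_0: "d (Suc 0) ` free_mod (b (Suc 0)) = {x \<in> free_mod (b 0). e x = 0}"
  using res by (simp_all add: free_resolution_def)

lemma d_image: "d (Suc (Suc i)) ` free_mod (b (Suc (Suc i))) = {x \<in> free_mod (b (Suc i)). d (Suc i) x = 0}"
  using res by (simp add: free_resolution_def)

lemma e_exact: "x \<in> free_mod (b 0) \<Longrightarrow> e x = 0 \<Longrightarrow> \<exists>z \<in> free_mod (b (Suc 0)). d (Suc 0) z = x"
  using d_image_0 by (force simp: set_eq_iff image_iff)

lemma d_exact: "x \<in> free_mod (b (Suc i)) \<Longrightarrow> d (Suc i) x = 0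
    \<Longrightarrow> \<exists>z \<in> free_mod (b (Suc (Suc i))). d (Suc (Suc i)) z = x"
  using d_image[of i] by (force simp: set_eq_iff image_iff)

lemma e_d: "x \<in> free_mod (b (Suc 0)) \<Longrightarrow> e (d (Suc 0) x) = 0"
  using d_image_0 by blast

lemma d_d: "x \<in> free_mod (b (Suc (Suc i))) \<Longrightarrow> d (Suc i) (d (Suc (Suc i)) x) = 0"
  using d_image[of i] by blast

lemma F_subspace: "vec.subspace (F j i)"
  by (rule subspace_ideal_free[OF ideal_power_ideal])

lemmas F_0 = vec.subspace_0[OF F_subspace]
lemmas F_add = vec.subspace_add[OF F_subspace]
lemmas F_diff = vec.subspace_diff[OF F_subspace]
lemmas F_neg = vec.subspace_neg[OF F_subspace]

lemma F_free: "x \<in> F j i \<Longrightarrow> x \<in> free_mod (b i)"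
  by (simp add: ideal_free_def)

lemma F_antimono: "x \<in> F j i \<Longrightarrow> k \<le> j \<Longrightarrow> x \<in> F k i"
  using ideal_free_antimono by blast

lemma e_filt: "e ` F j 0 = ideal_smult s (ideal_power m j) UNIV"
  using image_ideal_free[OF e_hom ideal_power_ideal] by (simp add: e_surj)

lemma e_kernel_filt: "x \<in> free_mod (b 0) \<Longrightarrow> e x = 0 \<Longrightarrow> x \<in> F 1 0"
  using e_exact[of x] d_minimal[of 0] by (force simp: ideal_power_1[OF ideal_m])

lemma d_kernel_filt: "x \<in> free_mod (b (Suc i)) \<Longrightarrow> d (Suc i) x = 0 \<Longrightarrow> x \<in> F 1 (Suc i)"
  using d_exact[of x i] d_minimal[of "Suc i"]
  by (force simp: ideal_power_1[OF ideal_m])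

subsection \<open>Homology of the linear part in terms of elements\<close>

lemma filtration: "lin_filtration m b n i = F (n - i) i"
  by (simp add: lin_filtration_def ideal_smult_free_mod[OF ideal_power_ideal])

lemma coset_eq_iff: "x +o F j i = y +o F j i \<longleftrightarrow> x - y \<in> F j i"
proof
  assume "x +o F j i = y +o F j i"
  moreover have "x + 0 \<in> x +o F j i" using F_0 by (rule set_plus_intro2)
  ultimately obtain u where "u \<in> F j i" "x = y + u" by (auto simp: elt_set_plus_def)
  then show "x - y \<in> F j i" by simp
next
  assume xy: "x - y \<in> F j i"
  have "x + u = y + ((x - y) + u)" "y + u = x + (u - (x - y))" for u by simp_all
  then show "x +o F j i = y +o F j i"
    unfolding elt_set_plus_def using F_add[OF xy] F_diff[OF _ xy] by blast
qed

lemma coset_zero_iff: "y +o F j i = F j i \<longleftrightarrow> y \<in> F j i"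
  using coset_eq_iff[of y j i 0] by simp

lemma coset_image_subset_iff:
  "(\<lambda>x. x +o F j i) ` A \<subseteq> (\<lambda>z. f z +o F j i) ` B \<longleftrightarrow> (\<forall>x \<in> A. \<exists>z \<in> B. x - f z \<in> F j i)"
  by (simp add: image_subset_iff image_iff coset_eq_iff)

lemma lin_diff_coset:
  "lin_diff m b d n (Suc i) (x +o lin_filtration m b (n + 1) (Suc i))
     = d (Suc i) x +o lin_filtration m b (n + 1) i"
proof -
  have "d (Suc i) v \<in> F (n + 1 - i) i" if "v \<in> F (n - i) (Suc i)" for v
    using d_filt[OF that] by (rule F_antimono) simp
  moreover have "0 \<in> F (n - i) (Suc i)" by (rule F_0)
  ultimately show ?thesis
    unfolding lin_diff_def filtration elt_set_plus_def set_plus_def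
    by (auto simp: D.add add.assoc image_iff) (metis F_add Suc_eq_plus1)
qed

lemma lin_cycles_eq:
  "lin_cycles m b d n (Suc i) =
     (\<lambda>x. x +o F (n - i) (Suc i)) ` {x \<in> F (n - Suc i) (Suc i). d (Suc i) x \<in> F (n + 1 - i) i}"
  using lin_diff_coset[of n i] coset_zero_iff[of _ "n + 1 - i" i]
  unfolding lin_cycles_def lin_part_def filtration by auto

lemma lin_boundaries_eq:
  "lin_boundaries m b d n (Suc i) =
     (\<lambda>z. d (Suc (Suc i)) z +o F (n - i) (Suc i)) ` F (n - Suc (Suc i)) (Suc (Suc i))"
  using lin_diff_coset[of n "Suc i"]
  unfolding lin_boundaries_def lin_part_def filtration by (auto simp: image_iff)

lemma lin_homology_nonzero_iff: "lin_homology_nonzero m b d (Suc i) \<longleftrightarrow> \<not> lin_acyclic m b d i"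
proof -
  have "lin_boundaries m b d n (Suc i) \<subseteq> lin_cycles m b d n (Suc i)" for n
  proof -
    have "d (Suc (Suc i)) z \<in> F (n - Suc i) (Suc i) \<and> d (Suc i) (d (Suc (Suc i)) z) \<in> F (n + 1 - i) i"
      if "z \<in> F (n - Suc (Suc i)) (Suc (Suc i))" for z
      using F_antimono[OF d_filt[OF that], of "n - Suc i"] d_d[OF F_free[OF that]] F_0 by auto
    then show ?thesis unfolding lin_cycles_eq lin_boundaries_eq by blast
  qed
  then have "lin_homology_nonzero m b d (Suc i) \<longleftrightarrow>
      (\<exists>n. \<not> lin_cycles m b d n (Suc i) \<subseteq> lin_boundaries m b d n (Suc i))"
    unfolding lin_homology_nonzero_def by blast
  also have "\<dots> \<longleftrightarrow> \<not> (\<forall>n. \<forall>x \<in> F (n - Suc i) (Suc i). d (Suc i) x \<in> F (n + 1 - i) i \<longrightarrow>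
      (\<exists>z \<in> F (n - Suc (Suc i)) (Suc (Suc i)). x - d (Suc (Suc i)) z \<in> F (n - i) (Suc i)))"
    unfolding lin_cycles_eq lin_boundaries_eq coset_image_subset_iff by (simp add: Bex_def)
  also have "(\<forall>n. \<forall>x \<in> F (n - Suc i) (Suc i). d (Suc i) x \<in> F (n + 1 - i) i \<longrightarrow>
      (\<exists>z \<in> F (n - Suc (Suc i)) (Suc (Suc i)). x - d (Suc (Suc i)) z \<in> F (n - i) (Suc i)))
      \<longleftrightarrow> lin_acyclic m b d i" (is "(\<forall>n. ?P n) \<longleftrightarrow> _")
  proof
    assume *: "\<forall>n. ?P n"
    show "lin_acyclic m b d i"
      unfolding lin_acyclic_def
    proof
      fix j
      show "\<forall>x\<in>F j (Suc i). d (Suc i) x \<in> F (j + 2) i \<longrightarrow>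
          (\<exists>z\<in>F (j - 1) (Suc (Suc i)). x - d (Suc (Suc i)) z \<in> F (Suc j) (Suc i))"
        using *[rule_format, of _ "j + Suc i"] by (simp add: Suc_diff_le)
    qed
  next
    assume acyc: "lin_acyclic m b d i"
    show "\<forall>n. ?P n"
    proof
      fix n
      show "?P n"
      proof (cases "n \<ge> Suc i")
        case True
        then obtain j where "n = j + Suc i" by (metis add.commute le_Suc_ex)
        then show ?thesis
          using acyc[unfolded lin_acyclic_def, rule_format, of _ j] by (simp add: Suc_diff_le)
      next
        \<comment> \<open>In filtration degrees below the homological degree the linear part is zero.\<close>
        case False
        then have "F (n - i) (Suc i) = F (n - Suc i) (Suc i)" by simp
        then show ?thesis using D.zero F_0 by (metis diff_zero)
      qed
    qed
  qed
  finally show ?thesis .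
qed

lemma lin_sup_le_iff:
  "lin_sup m b d \<le> enat k \<longleftrightarrow> (\<forall>i \<ge> k. lin_acyclic m b d i)"
proof -
  have "lin_sup m b d \<le> enat k \<longleftrightarrow> (\<forall>i. lin_homology_nonzero m b d i \<longrightarrow> i \<le> k)"
    unfolding lin_sup_def by (auto simp: Sup_le_iff)
  also have "\<dots> \<longleftrightarrow> (\<forall>i \<ge> k. \<not> lin_homology_nonzero m b d (Suc i))"
    by (metis Suc_le_eq le_eq_less_or_eq not_less not_less_eq_eq Suc_le_D)
  finally show ?thesis by (simp add: lin_homology_nonzero_iff)
qed

lemma lin_sup_0_iff: "lin_sup m b d = 0 \<longleftrightarrow> (\<forall>i. lin_acyclic m b d i)"
  using lin_sup_le_iff[of 0] by (simp add: zero_enat_def[symmetric])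

text \<open>Where the linear part is exact, the differential is strict: a boundary in \<open>m\<^sup>j\<^sup>+\<^sup>1F\<close> comes from \<open>m\<^sup>jF\<close>. A preimage
  is pushed down the filtration one step at a time, each time by subtracting a cycle.\<close>

lemma lin_acyclic_strict:
  assumes "lin_acyclic m b d i" "x \<in> free_mod (b (Suc i))" "d (Suc i) x \<in> F (Suc j) i"
  obtains y where "y \<in> F j (Suc i)" "d (Suc i) y = d (Suc i) x"
proof -
  have "\<exists>y \<in> F k (Suc i). d (Suc i) y = d (Suc i) x" if "k \<le> j" for k
    using that
  proof (induction k)
    case 0
    then show ?case using assms(2) by (auto simp: ideal_free_def)
  next
    case (Suc k)
    then obtain y where y: "y \<in> F k (Suc i)" "d (Suc i) y = d (Suc i) x" by auto
    have "d (Suc i) y \<in> F (k + 2) i"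
      using F_antimono[OF assms(3), of "k + 2"] Suc.prems by (simp add: y)
    then obtain z where z: "z \<in> F (k - 1) (Suc (Suc i))"
        "y - d (Suc (Suc i)) z \<in> F (Suc k) (Suc i)"
      using assms(1) y(1) unfolding lin_acyclic_def by blast
    moreover have "d (Suc i) (y - d (Suc (Suc i)) z) = d (Suc i) x"
      by (simp only: D.diff y(2) d_d[OF F_free[OF z(1)]] diff_zero)
    ultimately show ?case by blast
  qed
  then show thesis using that by blast
qed

end

section \<open>Lifting along acyclic complexes\<close>

text \<open>Solves \<open>d h\<^sub>i\<^sub>+\<^sub>1 = \<gamma>\<^sub>i + c h\<^sub>i d\<close> degree by degree: the right hand side is a cycle, and \<open>D\<close> is exact. With
  \<open>\<gamma> = 0\<close> and \<open>c = 1\<close> the solutions are comparison maps. With \<open>c = - 1\<close> they are null homotopies of \<open>\<gamma>\<close>, for \<open>D\<close> shifted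
  by one, and the twisting maps of the horseshoe, for \<open>C\<close> shifted by one and \<open>\<gamma> = 0\<close>.\<close>

lemma chain_lift:
  fixes c :: "'r::comm_ring_1"
    and dC dD \<gamma> :: "nat \<Rightarrow> (nat \<Rightarrow> 'r) \<Rightarrow> nat \<Rightarrow> 'r"
  assumes C: "\<And>i. module_hom vscale vscale (dC (Suc i))"
      "\<And>i x. x \<in> free_mod (bC (Suc i)) \<Longrightarrow> dC (Suc i) x \<in> free_mod (bC i)"
      "\<And>i x. x \<in> free_mod (bC (Suc (Suc i))) \<Longrightarrow> dC (Suc i) (dC (Suc (Suc i)) x) = 0"
    and D: "\<And>i. module_hom vscale vscale (dD (Suc i))"
      "\<And>i x. x \<in> free_mod (bD (Suc i)) \<Longrightarrow> dD (Suc i) x = 0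
        \<Longrightarrow> \<exists>z \<in> free_mod (bD (Suc (Suc i))). dD (Suc (Suc i)) z = x"
    and \<gamma>: "\<And>i. module_hom vscale vscale (\<gamma> i)"
      "\<And>i x. x \<in> free_mod (bC (Suc i)) \<Longrightarrow> \<gamma> i x \<in> free_mod (bD i)"
      "\<And>i x. x \<in> free_mod (bC (Suc (Suc i)))
        \<Longrightarrow> dD (Suc i) (\<gamma> (Suc i) x) + vscale c (\<gamma> i (dC (Suc (Suc i)) x)) = 0"
    and h0: "module_hom vscale vscale h0" "\<And>x. x \<in> free_mod (bC 0) \<Longrightarrow> h0 x \<in> free_mod (bD 0)"
      "\<And>x. x \<in> free_mod (bC (Suc 0))
        \<Longrightarrow> \<gamma> 0 x + vscale c (h0 (dC (Suc 0) x)) \<in> dD (Suc 0) ` free_mod (bD (Suc 0))"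
  obtains h where "h 0 = h0" "\<And>i. module_hom vscale vscale (h i)"
    "\<And>i x. x \<in> free_mod (bC i) \<Longrightarrow> h i x \<in> free_mod (bD i)"
    "\<And>i x. x \<in> free_mod (bC (Suc i))
      \<Longrightarrow> dD (Suc i) (h (Suc i) x) = \<gamma> i x + vscale c (h i (dC (Suc i) x))"
proof -
  define P where "P n h \<longleftrightarrow> (n = 0 \<longrightarrow> h = h0) \<and> module_hom vscale vscale h
      \<and> (\<forall>x \<in> free_mod (bC n). h x \<in> free_mod (bD n))
      \<and> (\<forall>x \<in> free_mod (bC (Suc n)).
            \<gamma> n x + vscale c (h (dC (Suc n) x)) \<in> dD (Suc n) ` free_mod (bD (Suc n)))" for n h
  define Q where "Q n h h' \<longleftrightarrow> (\<forall>x \<in> free_mod (bC (Suc n)).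
      dD (Suc n) (h' x) = \<gamma> n x + vscale c (h (dC (Suc n) x)))" for n h h'
  have "\<exists>h. \<forall>n. P n (h n) \<and> Q n (h n) (h (Suc n))"
  proof (rule dependent_nat_choice)
    show "\<exists>h. P 0 h" unfolding P_def using h0 by blast
  next
    fix h n
    assume "P n h"
    then have h: "module_hom vscale vscale h" "\<And>x. x \<in> free_mod (bC n) \<Longrightarrow> h x \<in> free_mod (bD n)"
        "\<And>x. x \<in> free_mod (bC (Suc n)) \<Longrightarrow>
            \<gamma> n x + vscale c (h (dC (Suc n) x)) \<in> dD (Suc n) ` free_mod (bD (Suc n))"
      by (auto simp: P_def)
    interpret dD: module_hom vscale vscale "dD (Suc n)" by (rule D)
    interpret h: module_hom vscale vscale h by (rule h)
    have u: "module_hom vscale vscale (\<lambda>x. \<gamma> n x + vscale c (h (dC (Suc n) x)))"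
      by (intro vec_pair.module_hom_add vec_pair.module_hom_scale \<gamma>
          module_hom_compose[OF C(1) h(1), unfolded o_def])
    obtain h' where h': "module_hom vscale vscale h'" "\<And>x. h' x \<in> free_mod (bD (Suc n))"
        "\<And>x. x \<in> free_mod (bC (Suc n)) \<Longrightarrow> dD (Suc n) (h' x) = \<gamma> n x + vscale c (h (dC (Suc n) x))"
      using free_mod_lift[OF u D(1)[of n] subspace_free_mod[of "bD (Suc n)"] h(3)[OF unit_vec_free]]
      by blast
    have "P (Suc n) h'"
      unfolding P_def
    proof (intro conjI ballI)
      fix x :: "nat \<Rightarrow> 'r"
      assume x: "x \<in> free_mod (bC (Suc (Suc n)))"
      let ?w = "\<gamma> (Suc n) x + vscale c (h' (dC (Suc (Suc n)) x))"
      have "?w \<in> free_mod (bD (Suc n))"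
        by (intro vec.subspace_add vec.subspace_scale subspace_free_mod h' \<gamma> x)
      moreover have "dD (Suc n) ?w
          = dD (Suc n) (\<gamma> (Suc n) x) + vscale c (\<gamma> n (dC (Suc (Suc n)) x))"
        by (simp only: dD.add dD.scale h'(3)[OF C(2)[OF x]] C(3)[OF x] h.zero
            vec.scale_zero_right add_0_right)
      ultimately show "?w \<in> dD (Suc (Suc n)) ` free_mod (bD (Suc (Suc n)))"
        using D(2) \<gamma>(3)[OF x] by (metis image_eqI)
    qed (use h' in auto)
    moreover have "Q n h h'" unfolding Q_def using h' by blast
    ultimately show "\<exists>h'. P (Suc n) h' \<and> Q n h h'" by blast
  qed
  then obtain h where "\<forall>n. P n (h n) \<and> Q n (h n) (h (Suc n))" ..
  then show thesis using that[of h] unfolding P_def Q_def by blast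
qed

section \<open>The linear part does not depend on the resolution\<close>

lemma comparison_map:
  assumes "min_res m s b d e" "min_res m s b' d' e'"
  obtains \<alpha> where "\<And>i. module_hom vscale vscale (\<alpha> i)"
    "\<And>i x. x \<in> free_mod (b i) \<Longrightarrow> \<alpha> i x \<in> free_mod (b' i)"
    "\<And>x. x \<in> free_mod (b 0) \<Longrightarrow> e' (\<alpha> 0 x) = e x"
    "\<And>i x. x \<in> free_mod (b (Suc i)) \<Longrightarrow> d' (Suc i) (\<alpha> (Suc i) x) = \<alpha> i (d (Suc i) x)"
proof -
  interpret F: min_res m s b d e by fact
  interpret F': min_res m s b' d' e' by fact
  have "e x \<in> e' ` free_mod (b' 0)" for x by (simp add: F'.e_surj)
  then obtain \<alpha>0 where \<alpha>0: "module_hom vscale vscale \<alpha>0" "\<And>x. \<alpha>0 x \<in> free_mod (b' 0)"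
      "\<And>x. x \<in> free_mod (b 0) \<Longrightarrow> e' (\<alpha>0 x) = e x"
    using free_mod_lift[OF F.e_hom F'.e_hom subspace_free_mod, of "b 0" "b' 0"] by metis
  have init: "\<alpha>0 (d (Suc 0) x) \<in> d' (Suc 0) ` free_mod (b' (Suc 0))"
    if "x \<in> free_mod (b (Suc 0))" for x
    unfolding F'.d_image_0 using \<alpha>0(2) \<alpha>0(3)[OF F.d_free[OF that]] F.e_d[OF that] by simp
  obtain \<alpha> where "\<alpha> 0 = \<alpha>0" "\<And>i. module_hom vscale vscale (\<alpha> i)"
      "\<And>i x. x \<in> free_mod (b i) \<Longrightarrow> \<alpha> i x \<in> free_mod (b' i)"
      "\<And>i x. x \<in> free_mod (b (Suc i)) \<Longrightarrow> d' (Suc i) (\<alpha> (Suc i) x) = 0 + vscale 1 (\<alpha> i (d (Suc i) x))"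
    by (rule chain_lift[where dC = d and bC = b and dD = d' and bD = b' and \<gamma> = "\<lambda>_ _. 0"
          and c = 1 and ?h0.0 = \<alpha>0])
      (auto simp: F.d_free F.d_d F.d_hom F'.d_hom F'.d_exact \<alpha>0 vec_pair.module_hom_zero F'.D.zero
        vec.subspace_0[OF subspace_free_mod] init)
  then show thesis using that[of \<alpha>] \<alpha>0(3) by simp
qed

text \<open>An endomorphism of the resolution over the zero map is homotopic to zero, \<open>\<gamma> = dh + hd\<close>; since \<open>d\<close> raises
  the \<open>m\<close>-adic order, it vanishes on the linear part.\<close>

lemma (in min_res) null_homotopic_filt:
  assumes \<gamma>: "\<And>i. module_hom vscale vscale (\<gamma> i)"
      "\<And>i x. x \<in> free_mod (b i) \<Longrightarrow> \<gamma> i x \<in> free_mod (b i)"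
      "\<And>x. x \<in> free_mod (b 0) \<Longrightarrow> e (\<gamma> 0 x) = 0"
      "\<And>i x. x \<in> free_mod (b (Suc i)) \<Longrightarrow> d (Suc i) (\<gamma> (Suc i) x) = \<gamma> i (d (Suc i) x)"
    and x: "x \<in> F j (Suc i)"
  shows "\<gamma> (Suc i) x \<in> F (Suc j) (Suc i)"
proof -
  interpret \<gamma>: module_hom vscale vscale "\<gamma> k" for k by (rule \<gamma>)
  have "\<gamma> 0 x \<in> d (Suc 0) ` free_mod (b (Suc 0))" if "x \<in> free_mod (b 0)" for x
    unfolding d_image_0 using \<gamma> that by simp
  then obtain h0 where h0: "module_hom vscale vscale h0" "\<And>x. h0 x \<in> free_mod (b (Suc 0))"
      "\<And>x. x \<in> free_mod (b 0) \<Longrightarrow> d (Suc 0) (h0 x) = \<gamma> 0 x"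
    using free_mod_lift[OF \<gamma>(1) d_hom subspace_free_mod, of "b 0" 0 0 "b (Suc 0)"] unit_vec_free
    by metis
  have init: "\<gamma> (Suc 0) y + vscale (- 1) (h0 (d (Suc 0) y)) \<in> d (Suc (Suc 0)) ` free_mod (b (Suc (Suc 0)))"
    if y: "y \<in> free_mod (b (Suc 0))" for y
  proof -
    have "\<gamma> (Suc 0) y + vscale (- 1) (h0 (d (Suc 0) y)) \<in> free_mod (b (Suc 0))"
      by (intro vec.subspace_add vec.subspace_scale subspace_free_mod \<gamma> h0 y)
    moreover have "d (Suc 0) (\<gamma> (Suc 0) y + vscale (- 1) (h0 (d (Suc 0) y))) = 0"
      by (simp only: D.add D.scale \<gamma>(4)[OF y] h0(3)[OF d_free[OF y]] vec.scale_minus_left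
          vec.scale_one D.neg add.right_inverse)
    ultimately show ?thesis unfolding d_image by blast
  qed
  obtain h where h: "h 0 = h0" "\<And>i. module_hom vscale vscale (h i)"
      "\<And>i x. x \<in> free_mod (b i) \<Longrightarrow> h i x \<in> free_mod (b (Suc i))"
      "\<And>i x. x \<in> free_mod (b (Suc i))
        \<Longrightarrow> d (Suc (Suc i)) (h (Suc i) x) = \<gamma> (Suc i) x + vscale (- 1) (h i (d (Suc i) x))"
    by (rule chain_lift[where dC = d and bC = b and dD = "\<lambda>i. d (Suc i)" and bD = "\<lambda>i. b (Suc i)"
          and \<gamma> = "\<lambda>i. \<gamma> (Suc i)" and c = "- 1" and ?h0.0 = h0])
      (auto simp: d_free d_d d_hom d_exact h0 \<gamma> init[simplified])
  have "\<gamma> (Suc i) x = d (Suc (Suc i)) (h (Suc i) x) + h i (d (Suc i) x)"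
    using h(4)[OF F_free[OF x]] by (simp add: vec.scale_minus_left)
  moreover have "d (Suc (Suc i)) (h (Suc i) x) \<in> F (Suc j) (Suc i)"
    by (intro d_filt ideal_free_map[OF h(2) _ x]) (use h(3) in blast)
  moreover have "h i (d (Suc i) x) \<in> F (Suc j) (Suc i)"
    by (intro ideal_free_map[OF h(2) _ d_filt[OF x]]) (use h(3) in blast)
  ultimately show ?thesis using F_add by simp
qed

text \<open>The comparison maps \<open>\<alpha>\<close> and \<open>\<beta>\<close> preserve the filtrations, and \<open>1 - \<beta>\<alpha>\<close> covers the zero map, so that \<open>\<beta>\<alpha>\<close> is
  the identity on the linear part.\<close>

lemma lin_acyclic_transfer:
  assumes "min_res m s b d e" "min_res m s b' d' e'" and acyc: "lin_acyclic m b' d' i"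
  shows "lin_acyclic m b d i"
proof -
  interpret F: min_res m s b d e by fact
  interpret F': min_res m s b' d' e' by fact
  obtain \<alpha> where \<alpha>: "\<And>i. module_hom vscale vscale (\<alpha> i)"
    "\<And>i x. x \<in> free_mod (b i) \<Longrightarrow> \<alpha> i x \<in> free_mod (b' i)"
    "\<And>x. x \<in> free_mod (b 0) \<Longrightarrow> e' (\<alpha> 0 x) = e x"
    "\<And>i x. x \<in> free_mod (b (Suc i)) \<Longrightarrow> d' (Suc i) (\<alpha> (Suc i) x) = \<alpha> i (d (Suc i) x)"
    using comparison_map[OF assms(1,2)] by blast
  obtain \<beta> where \<beta>: "\<And>i. module_hom vscale vscale (\<beta> i)"
    "\<And>i x. x \<in> free_mod (b' i) \<Longrightarrow> \<beta> i x \<in> free_mod (b i)"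
    "\<And>x. x \<in> free_mod (b' 0) \<Longrightarrow> e (\<beta> 0 x) = e' x"
    "\<And>i x. x \<in> free_mod (b' (Suc i)) \<Longrightarrow> d (Suc i) (\<beta> (Suc i) x) = \<beta> i (d' (Suc i) x)"
    using comparison_map[OF assms(2,1)] by blast
  interpret \<alpha>: module_hom vscale vscale "\<alpha> k" for k by (rule \<alpha>)
  interpret \<beta>: module_hom vscale vscale "\<beta> k" for k by (rule \<beta>)
  have \<alpha>_filt: "\<alpha> i x \<in> F'.F j i" if "x \<in> F.F j i" for i j x
    by (rule ideal_free_map[OF \<alpha>(1) _ that]) (use \<alpha>(2) in blast)
  have \<beta>_filt: "\<beta> i x \<in> F.F j i" if "x \<in> F'.F j i" for i j x
    by (rule ideal_free_map[OF \<beta>(1) _ that]) (use \<beta>(2) in blast)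
  have id: "x - \<beta> (Suc i) (\<alpha> (Suc i) x) \<in> F.F (Suc j) (Suc i)" if x: "x \<in> F.F j (Suc i)" for i j x
  proof (rule F.null_homotopic_filt[where \<gamma> = "\<lambda>i x. x - \<beta> i (\<alpha> i x)", OF _ _ _ _ x])
    show "module_hom vscale vscale (\<lambda>x. x - \<beta> i (\<alpha> i x))" for i
      by (intro vec_pair.module_hom_sub vec.module_hom_ident module_hom_compose[OF \<alpha>(1) \<beta>(1), unfolded o_def])
    show "x - \<beta> i (\<alpha> i x) \<in> free_mod (b i)" if "x \<in> free_mod (b i)" for i x
      by (intro vec.subspace_diff subspace_free_mod that \<alpha> \<beta>)
    show "e (x - \<beta> 0 (\<alpha> 0 x)) = 0" if "x \<in> free_mod (b 0)" for x
      by (simp only: F.E.diff \<beta>(3)[OF \<alpha>(2)[OF that]] \<alpha>(3)[OF that] diff_self)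
    show "d (Suc i) (x - \<beta> (Suc i) (\<alpha> (Suc i) x)) = d (Suc i) x - \<beta> i (\<alpha> i (d (Suc i) x))"
      if "x \<in> free_mod (b (Suc i))" for i x
      by (simp only: F.D.diff \<beta>(4)[OF \<alpha>(2)[OF that]] \<alpha>(4)[OF that])
  qed
  show ?thesis
    unfolding lin_acyclic_def
  proof (intro allI ballI impI)
    fix j x
    assume x: "x \<in> F.F j (Suc i)" and dx: "d (Suc i) x \<in> F.F (j + 2) i"
    have "d' (Suc i) (\<alpha> (Suc i) x) \<in> F'.F (j + 2) i"
      using \<alpha>_filt[OF dx] \<alpha>(4)[OF F.F_free[OF x]] by simp
    then obtain z where z: "z \<in> F'.F (j - 1) (Suc (Suc i))"
        "\<alpha> (Suc i) x - d' (Suc (Suc i)) z \<in> F'.F (Suc j) (Suc i)"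
      using acyc[unfolded lin_acyclic_def, rule_format, OF \<alpha>_filt[OF x]] by blast
    have eq: "x - d (Suc (Suc i)) (\<beta> (Suc (Suc i)) z)
        = (x - \<beta> (Suc i) (\<alpha> (Suc i) x)) + \<beta> (Suc i) (\<alpha> (Suc i) x - d' (Suc (Suc i)) z)"
      by (simp only: \<beta>(4)[OF F'.F_free[OF z(1)]] \<beta>.diff) simp
    have "x - d (Suc (Suc i)) (\<beta> (Suc (Suc i)) z) \<in> F.F (Suc j) (Suc i)"
      unfolding eq by (rule F.F_add[OF id[OF x] \<beta>_filt[OF z(2)]])
    then show "\<exists>z \<in> F.F (j - 1) (Suc (Suc i)). x - d (Suc (Suc i)) z \<in> F.F (Suc j) (Suc i)"
      using \<beta>_filt[OF z(1)] by blast
  qed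
qed

lemma enat_eqI_le: "(\<And>k. x \<le> enat k \<longleftrightarrow> y \<le> enat k) \<Longrightarrow> x = y"
  by (metis enat_ord_code(3) enat.exhaust order_antisym order_refl)

lemma lin_sup_unique:
  assumes "min_res m s b d e" "min_res m s b' d' e'"
  shows "lin_sup m b d = lin_sup m b' d'"
  using lin_acyclic_transfer[OF assms] lin_acyclic_transfer[OF assms(2,1)]
  by (intro enat_eqI_le)
    (auto simp: min_res.lin_sup_le_iff[OF assms(1)] min_res.lin_sup_le_iff[OF assms(2)])

section \<open>The horseshoe resolution\<close>

text \<open>The vector \<open>f + shift r h\<close> is the pair \<open>(f, h)\<close> under \<open>R\<^sup>r\<^sup>+\<^sup>t = R\<^sup>r \<oplus> R\<^sup>t\<close>.\<close>

definition shift :: "nat \<Rightarrow> (nat \<Rightarrow> 'r) \<Rightarrow> nat \<Rightarrow> 'r::comm_ring_1" where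
  "shift r h = (\<lambda>k. if k < r then 0 else h (k - r))"

definition trunc :: "nat \<Rightarrow> (nat \<Rightarrow> 'r) \<Rightarrow> nat \<Rightarrow> 'r::comm_ring_1" where
  "trunc r g = (\<lambda>k. if k < r then g k else 0)"

definition unshift :: "nat \<Rightarrow> (nat \<Rightarrow> 'r) \<Rightarrow> nat \<Rightarrow> 'r::comm_ring_1" where
  "unshift r g = (\<lambda>k. g (k + r))"

lemma module_hom_shift: "module_hom vscale vscale (shift r)"
  by unfold_locales (auto simp: shift_def vscale_def)

lemma module_hom_trunc: "module_hom vscale vscale (trunc r)"
  by unfold_locales (auto simp: trunc_def vscale_def)

lemma module_hom_unshift: "module_hom vscale vscale (unshift r)"
  by unfold_locales (auto simp: unshift_def vscale_def)

lemma unshift_pair: "f \<in> free_mod r \<Longrightarrow> unshift r (f + shift r h) = h"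
  by (auto simp: unshift_def shift_def free_mod_def)

lemma trunc_pair: "f \<in> free_mod r \<Longrightarrow> trunc r (f + shift r h) = f"
  by (auto simp: trunc_def shift_def free_mod_def fun_eq_iff)

lemma pair_decomp: "g = trunc r g + shift r (unshift r g)"
  by (auto simp: trunc_def shift_def unshift_def fun_eq_iff)

lemma trunc_free: "trunc r g \<in> free_mod r"
  by (simp add: trunc_def free_mod_def)

lemma unshift_free: "g \<in> free_mod (r + t) \<Longrightarrow> unshift r g \<in> free_mod t"
  by (simp add: unshift_def free_mod_def)

lemma pair_ideal_free_iff:
  assumes "ideal I" "f \<in> free_mod r" "h \<in> free_mod t"
  shows "f + shift r h \<in> ideal_free I (r + t) \<longleftrightarrow> f \<in> ideal_free I r \<and> h \<in> ideal_free I t"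
proof
  assume *: "f + shift r h \<in> ideal_free I (r + t)"
  have "h k \<in> I" for k
    using * assms(2) by (auto simp: ideal_free_def shift_def free_mod_def dest!: spec[of _ "k + r"])
  moreover have "f k \<in> I" for k
    using * assms(2) ring.subspace_0[OF assms(1)]
    by (cases "k < r") (auto simp: ideal_free_def shift_def free_mod_def dest!: spec[of _ k])
  ultimately show "f \<in> ideal_free I r \<and> h \<in> ideal_free I t"
    using assms by (simp add: ideal_free_def)
next
  assume "f \<in> ideal_free I r \<and> h \<in> ideal_free I t"
  then show "f + shift r h \<in> ideal_free I (r + t)"
    using ring.subspace_add[OF assms(1)] ring.subspace_0[OF assms(1)]
    by (auto simp: ideal_free_def free_mod_def shift_def)
qed

lemma pair_free: "f \<in> free_mod r \<Longrightarrow> h \<in> free_mod t \<Longrightarrow> f + shift r h \<in> free_mod (r + t)"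
  by (auto simp: free_mod_def shift_def)

text \<open>The horseshoe data: a lift \<open>\<mu>\<close> of the augmentation of \<open>H\<close> to \<open>P\<close>, and twisting maps \<open>\<theta>\<close> whose compatibility with
  the differentials says that \<open>d (f, h) = (d f + \<theta> h, d h)\<close> defines a complex over \<open>P\<close>.\<close>

locale koszul_extension =
  F: min_res m sM bF dF eM + H: min_res m sN bH dH eN
  for m :: "'r::comm_ring_1 set"
    and sM :: "'r \<Rightarrow> 'a::ab_group_add \<Rightarrow> 'a" and bF dF eM
    and sN :: "'r \<Rightarrow> 'c::ab_group_add \<Rightarrow> 'c" and bH dH eN +
  fixes sP :: "'r \<Rightarrow> 'b::ab_group_add \<Rightarrow> 'b" and \<phi> :: "'a \<Rightarrow> 'b" and \<psi> :: "'b \<Rightarrow> 'c"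
    and \<mu> :: "(nat \<Rightarrow> 'r) \<Rightarrow> 'b"
    and \<theta> :: "nat \<Rightarrow> (nat \<Rightarrow> 'r) \<Rightarrow> nat \<Rightarrow> 'r"
  assumes exact: "short_exact sM sP sN \<phi> \<psi>"
    and cond: "range \<phi> \<inter> ideal_smult sP m UNIV = ideal_smult sP m (range \<phi>)"
    and koszul: "\<And>i. lin_acyclic m bF dF i"
    and mu_hom: "module_hom vscale sP \<mu>"
    and mu: "\<And>h. h \<in> free_mod (bH 0) \<Longrightarrow> \<psi> (\<mu> h) = eN h"
    and theta_hom: "\<And>i. module_hom vscale vscale (\<theta> i)"
    and theta_free: "\<And>i h. h \<in> free_mod (bH (Suc i)) \<Longrightarrow> \<theta> i h \<in> free_mod (bF i)"
    and theta_0: "\<And>h. h \<in> free_mod (bH (Suc 0)) \<Longrightarrow> \<phi> (eM (\<theta> 0 h)) + \<mu> (dH (Suc 0) h) = 0"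
    and theta_Suc: "\<And>i h. h \<in> free_mod (bH (Suc (Suc i)))
      \<Longrightarrow> dF (Suc i) (\<theta> (Suc i) h) + \<theta> i (dH (Suc (Suc i)) h) = 0"
begin

sublocale \<phi>: module_hom sM sP \<phi>
  using exact by (simp add: short_exact_def)

sublocale \<psi>: module_hom sP sN \<psi>
  using exact by (simp add: short_exact_def)

sublocale \<mu>: module_hom vscale sP \<mu>
  by (rule mu_hom)

sublocale \<theta>: module_hom vscale vscale "\<theta> i" for i
  by (rule theta_hom)

lemma inj_\<phi>: "inj \<phi>" and range_\<phi>: "range \<phi> = {x. \<psi> x = 0}"
  using exact by (simp_all add: short_exact_def)

lemma phi_filt_iff: "\<phi> x \<in> ideal_smult sP I (range \<phi>) \<longleftrightarrow> x \<in> ideal_smult sM I UNIV"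
  by (simp add: ideal_smult_image[OF \<phi>.module_hom_axioms] inj_image_mem_iff[OF inj_\<phi>])

definition "bG i = bF i + bH i"

definition "dG i g = dF i (trunc (bF i) g) + \<theta> (i - 1) (unshift (bF i) g)
    + shift (bF (i - 1)) (dH i (unshift (bF i) g))"

definition "eG g = \<phi> (eM (trunc (bF 0) g)) + \<mu> (unshift (bF 0) g)"

abbreviation pair :: "nat \<Rightarrow> (nat \<Rightarrow> 'r) \<Rightarrow> (nat \<Rightarrow> 'r) \<Rightarrow> nat \<Rightarrow> 'r" where
  "pair i f h \<equiv> f + shift (bF i) h"

lemma dG_pair:
  assumes "f \<in> free_mod (bF (Suc i))"
  shows "dG (Suc i) (pair (Suc i) f h) = pair i (dF (Suc i) f + \<theta> i h) (dH (Suc i) h)"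
  by (simp add: dG_def trunc_pair[OF assms] unshift_pair[OF assms])

lemma eG_pair: "f \<in> free_mod (bF 0) \<Longrightarrow> eG (pair 0 f h) = \<phi> (eM f) + \<mu> h"
  by (simp add: eG_def trunc_pair unshift_pair)

lemma pairE:
  assumes "g \<in> free_mod (bG i)"
  obtains f h where "f \<in> free_mod (bF i)" "h \<in> free_mod (bH i)" "g = pair i f h"
  using pair_decomp[of g "bF i"] trunc_free[of "bF i" g] unshift_free[of g "bF i" "bH i"] assms
  unfolding bG_def by metis

lemma pair_in_free: "f \<in> free_mod (bF i) \<Longrightarrow> h \<in> free_mod (bH i) \<Longrightarrow> pair i f h \<in> free_mod (bG i)"
  by (simp add: pair_free bG_def)

abbreviation G :: "nat \<Rightarrow> nat \<Rightarrow> (nat \<Rightarrow> 'r) set" where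
  "G j i \<equiv> ideal_free (ideal_power m j) (bG i)"

lemma pair_filt_iff:
  "f \<in> free_mod (bF i) \<Longrightarrow> h \<in> free_mod (bH i) \<Longrightarrow> pair i f h \<in> G j i \<longleftrightarrow> f \<in> F.F j i \<and> h \<in> H.F j i"
  unfolding bG_def by (rule pair_ideal_free_iff[OF ideal_power_ideal])

lemma pairE_filt:
  assumes "g \<in> G j i"
  obtains f h where "f \<in> F.F j i" "h \<in> H.F j i" "g = pair i f h"
proof -
  have "g \<in> free_mod (bG i)" using assms by (simp add: ideal_free_def)
  then obtain f h where fh: "f \<in> free_mod (bF i)" "h \<in> free_mod (bH i)" "g = pair i f h"
    by (rule pairE)
  then show thesis using that[of f h] assms pair_filt_iff[OF fh(1,2)] by simp
qed

lemma pair_eq_iff: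
  assumes "f \<in> free_mod (bF i)" "f' \<in> free_mod (bF i)"
  shows "pair i f h = pair i f' h' \<longleftrightarrow> f = f' \<and> h = h'"
  using assms by (metis trunc_pair unshift_pair)

lemma shift_hom_diff: "shift r h - shift r h' = shift r (h - h')"
  by (simp add: module_hom.diff[OF module_hom_shift])

lemma pair_diff: "pair i f h - pair i f' h' = pair i (f - f') (h - h')"
  by (simp add: shift_hom_diff[symmetric] algebra_simps)

text \<open>The twisting maps are minimal. In degree 0 this is where \<open>M \<inter> mP = mM\<close> enters; higher up, \<open>d\<theta> = - \<theta>d\<close>
  carries \<open>H\<close> into \<open>m\<^sup>2F\<close>, and exactness of the linear part of \<open>F\<close> lifts this to \<open>\<theta>h \<in> mF\<close>.\<close>

lemma theta_minimal_0:
  assumes "h \<in> free_mod (bH (Suc 0))"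
  shows "\<theta> 0 h \<in> F.F 1 0"
proof -
  let ?t = "\<theta> 0 h"
  have dh: "dH (Suc 0) h \<in> ideal_free m (bH 0)"
    using H.d_minimal[of 0] assms by blast
  have "\<mu> (dH (Suc 0) h) \<in> ideal_smult sP m (\<mu> ` free_mod (bH 0))"
    using image_ideal_free[OF mu_hom F.ideal_m, of "bH 0"] dh by blast
  also have "\<dots> \<subseteq> ideal_smult sP m UNIV"
    unfolding ideal_smult_def by (intro \<phi>.m2.span_mono) blast
  finally have "- \<mu> (dH (Suc 0) h) \<in> ideal_smult sP m UNIV"
    by (rule \<phi>.m2.subspace_neg[OF subspace_ideal_smult[OF \<phi>.m2.module_axioms]])
  moreover have "\<phi> (eM ?t) = - \<mu> (dH (Suc 0) h)"
    using theta_0[OF assms] by (simp add: eq_neg_iff_add_eq_0)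
  ultimately have "\<phi> (eM ?t) \<in> ideal_smult sP m (range \<phi>)"
    using cond by (metis Int_iff rangeI)
  then have "eM ?t \<in> ideal_smult sM (ideal_power m 1) UNIV"
    by (simp add: phi_filt_iff ideal_power_1[OF F.ideal_m])
  then obtain f where f: "f \<in> F.F 1 0" "eM f = eM ?t"
    unfolding F.e_filt[symmetric] by auto
  have "?t - f \<in> F.F 1 0"
    by (intro F.e_kernel_filt vec.subspace_diff[OF subspace_free_mod] theta_free assms F.F_free[OF f(1)])
       (simp add: F.E.diff f(2))
  then show ?thesis using F.F_add[OF _ f(1)] by fastforce
qed

lemma theta_minimal: "h \<in> free_mod (bH (Suc i)) \<Longrightarrow> \<theta> i h \<in> F.F 1 i"
proof (induction i arbitrary: h)
  case 0
  then show ?case by (rule theta_minimal_0)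
next
  case (Suc i)
  let ?t = "\<theta> (Suc i) h"
  have "\<theta> i ` free_mod (bH (Suc i)) \<subseteq> ideal_free m (bF i)"
    using Suc.IH by (auto simp: ideal_power_1[OF F.ideal_m])
  moreover have "dH (Suc (Suc i)) h \<in> H.F 1 (Suc i)"
    by (rule H.d_kernel_filt[OF H.d_free[OF Suc.prems] H.d_d[OF Suc.prems]])
  ultimately have "\<theta> i (dH (Suc (Suc i)) h) \<in> F.F (Suc 1) i"
    by (rule ideal_free_minimal_map[OF theta_hom])
  moreover have "dF (Suc i) ?t = - \<theta> i (dH (Suc (Suc i)) h)"
    using theta_Suc[OF Suc.prems] by (simp add: eq_neg_iff_add_eq_0)
  ultimately have "dF (Suc i) ?t \<in> F.F (0 + 2) i"
    using F.F_neg by (simp add: numeral_2_eq_2)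
  moreover have "?t \<in> F.F 0 (Suc i)"
    using theta_free[OF Suc.prems] by (simp add: ideal_free_def)
  ultimately obtain z where z: "z \<in> F.F (0 - 1) (Suc (Suc i))"
      "?t - dF (Suc (Suc i)) z \<in> F.F (Suc 0) (Suc i)"
    using koszul[of i, unfolded lin_acyclic_def, rule_format] by blast
  have "dF (Suc (Suc i)) z \<in> F.F 1 (Suc i)"
    by (rule F.d_kernel_filt[OF F.d_free[OF F.F_free[OF z(1)]] F.d_d[OF F.F_free[OF z(1)]]])
  from F.F_add[OF z(2)[folded One_nat_def] this] show ?case by (simp only: diff_add_cancel)
qed

lemma theta_filt: "h \<in> H.F j (Suc i) \<Longrightarrow> \<theta> i h \<in> F.F (Suc j) i"
  using theta_minimal
  by (intro ideal_free_minimal_map[OF theta_hom]) (auto simp: ideal_power_1[OF F.ideal_m])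

lemma mu_free_0:
  assumes "f \<in> free_mod (bF 0)" "h \<in> free_mod (bH 0)" "\<phi> (eM f) + \<mu> h = 0"
  shows "eN h = 0"
proof -
  have "\<psi> (\<phi> (eM f)) = 0" using range_\<phi> by blast
  then show ?thesis using assms(3) mu[OF assms(2)] \<psi>.add[of "\<phi> (eM f)" "\<mu> h"] by simp
qed

lemma eG_hom: "module_hom vscale sP eG"
proof -
  interpret pr: module_pair "vscale :: 'r \<Rightarrow> (nat \<Rightarrow> 'r) \<Rightarrow> _" sP ..
  show ?thesis
    unfolding eG_def
    by (intro pr.module_hom_add module_hom_compose[unfolded o_def, OF _ mu_hom]
        module_hom_compose[unfolded o_def, OF _ \<phi>.module_hom_axioms]
        module_hom_compose[unfolded o_def, OF _ F.e_hom] module_hom_trunc module_hom_unshift)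
qed

lemma dG_hom: "module_hom vscale vscale (dG (Suc i))"
  unfolding dG_def diff_Suc_1
  by (intro vec_pair.module_hom_add module_hom_compose[unfolded o_def, OF _ theta_hom]
        module_hom_compose[unfolded o_def, OF _ F.d_hom] module_hom_compose[unfolded o_def, OF _ H.d_hom]
        module_hom_compose[unfolded o_def, OF _ module_hom_shift] module_hom_trunc module_hom_unshift)

lemma eG_surj: "eG ` free_mod (bG 0) = UNIV"
proof -
  have "\<exists>g \<in> free_mod (bG 0). eG g = p" for p
  proof -
    obtain h where h: "h \<in> free_mod (bH 0)" "eN h = \<psi> p"
      using H.e_surj by (metis UNIV_I imageE)
    then have "\<psi> (p - \<mu> h) = 0" by (simp add: \<psi>.diff mu)
    then obtain x where x: "p - \<mu> h = \<phi> x" using range_\<phi> by auto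
    obtain f where f: "f \<in> free_mod (bF 0)" "eM f = x"
      using F.e_surj by (metis UNIV_I imageE)
    have "eG (pair 0 f h) = p" using x f by (simp add: eG_pair diff_eq_eq)
    then show ?thesis using pair_in_free[OF f(1) h(1)] by blast
  qed
  then show ?thesis by (metis UNIV_eq_I imageI)
qed

lemma dG_filt_0: "g \<in> free_mod (bG (Suc i)) \<Longrightarrow> dG (Suc i) g \<in> G 1 i"
proof -
  assume "g \<in> free_mod (bG (Suc i))"
  then obtain f h where fh: "f \<in> free_mod (bF (Suc i))" "h \<in> free_mod (bH (Suc i))" "g = pair (Suc i) f h"
    by (rule pairE)
  have "dF (Suc i) f + \<theta> i h \<in> F.F 1 i"
    using F.d_filt[of f 0 i] fh theta_minimal[OF fh(2)] F.F_add by (simp add: ideal_free_UNIV[simplified])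
  moreover have "dH (Suc i) h \<in> H.F 1 i"
    using H.d_filt[of h 0 i] fh by (simp add: ideal_free_UNIV[simplified])
  ultimately show ?thesis
    by (simp add: fh(3) dG_pair[OF fh(1)] pair_filt_iff F.F_free H.F_free)
qed

lemma eG_exact: "dG (Suc 0) ` free_mod (bG (Suc 0)) = {g \<in> free_mod (bG 0). eG g = 0}"
proof safe
  fix g :: "nat \<Rightarrow> 'r" assume "g \<in> free_mod (bG (Suc 0))"
  then show "dG (Suc 0) g \<in> free_mod (bG 0)"
    using dG_filt_0 by (auto simp: ideal_free_def)
  obtain f h where fh: "f \<in> free_mod (bF (Suc 0))" "h \<in> free_mod (bH (Suc 0))" "g = pair (Suc 0) f h"
    using \<open>g \<in> _\<close> by (rule pairE)
  have "dF (Suc 0) f + \<theta> 0 h \<in> free_mod (bF 0)"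
    by (intro vec.subspace_add[OF subspace_free_mod] F.d_free theta_free fh)
  then show "eG (dG (Suc 0) g) = 0"
    using theta_0[OF fh(2)] F.e_d[OF fh(1)]
    by (simp add: fh(3) dG_pair[OF fh(1)] eG_pair F.E.add \<phi>.add)
next
  fix g :: "nat \<Rightarrow> 'r" assume "g \<in> free_mod (bG 0)" and eg: "eG g = 0"
  then obtain f h where fh: "f \<in> free_mod (bF 0)" "h \<in> free_mod (bH 0)" "g = pair 0 f h"
    by (blast elim: pairE)
  have e: "\<phi> (eM f) + \<mu> h = 0" using eg fh by (simp add: eG_pair)
  obtain h' where h': "h' \<in> free_mod (bH (Suc 0))" "dH (Suc 0) h' = h"
    using H.e_exact[OF fh(2) mu_free_0[OF fh(1,2) e]] by blast
  have "\<phi> (eM (f - \<theta> 0 h')) = \<phi> 0"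
    using e theta_0[OF h'(1)] h'(2) by (simp add: F.E.diff \<phi>.diff) (metis add_right_cancel)
  then have "eM (f - \<theta> 0 h') = 0" using inj_\<phi> by (meson injD)
  moreover have "f - \<theta> 0 h' \<in> free_mod (bF 0)"
    by (intro vec.subspace_diff[OF subspace_free_mod] theta_free fh h')
  ultimately obtain f' where f': "f' \<in> free_mod (bF (Suc 0))" "dF (Suc 0) f' = f - \<theta> 0 h'"
    using F.e_exact by blast
  have "dG (Suc 0) (pair (Suc 0) f' h') = g"
    by (simp add: dG_pair[OF f'(1)] f' h' fh)
  then show "g \<in> dG (Suc 0) ` free_mod (bG (Suc 0))"
    using pair_in_free[OF f'(1) h'(1)] by blast
qed

lemma dG_exact:
  "dG (Suc (Suc i)) ` free_mod (bG (Suc (Suc i))) = {g \<in> free_mod (bG (Suc i)). dG (Suc i) g = 0}"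
proof safe
  fix g :: "nat \<Rightarrow> 'r" assume "g \<in> free_mod (bG (Suc (Suc i)))"
  then show "dG (Suc (Suc i)) g \<in> free_mod (bG (Suc i))"
    using dG_filt_0 by (auto simp: ideal_free_def)
  obtain f h where fh: "f \<in> free_mod (bF (Suc (Suc i)))" "h \<in> free_mod (bH (Suc (Suc i)))"
      "g = pair (Suc (Suc i)) f h"
    using \<open>g \<in> _\<close> by (rule pairE)
  have fr: "dF (Suc (Suc i)) f + \<theta> (Suc i) h \<in> free_mod (bF (Suc i))"
    by (intro vec.subspace_add[OF subspace_free_mod] F.d_free theta_free fh)
  show "dG (Suc i) (dG (Suc (Suc i)) g) = 0"
    using theta_Suc[OF fh(2)]
    by (simp add: fh(3) dG_pair[OF fh(1)] dG_pair[OF fr] F.D.add F.d_d[OF fh(1)] H.d_d[OF fh(2)]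
        module_hom.zero[OF module_hom_shift])
next
  fix g :: "nat \<Rightarrow> 'r" assume "g \<in> free_mod (bG (Suc i))" and dg: "dG (Suc i) g = 0"
  then obtain f h where fh: "f \<in> free_mod (bF (Suc i))" "h \<in> free_mod (bH (Suc i))" "g = pair (Suc i) f h"
    by (blast elim: pairE)
  have fr: "dF (Suc i) f + \<theta> i h \<in> free_mod (bF i)"
    by (intro vec.subspace_add[OF subspace_free_mod] F.d_free theta_free fh)
  have "pair i (dF (Suc i) f + \<theta> i h) (dH (Suc i) h) = pair i 0 0"
    using dg fh by (simp add: dG_pair module_hom.zero[OF module_hom_shift])
  then have e: "dF (Suc i) f + \<theta> i h = 0" "dH (Suc i) h = 0"
    using pair_eq_iff[OF fr vec.subspace_0[OF subspace_free_mod]] by auto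
  obtain h' where h': "h' \<in> free_mod (bH (Suc (Suc i)))" "dH (Suc (Suc i)) h' = h"
    using H.d_exact[OF fh(2) e(2)] by blast
  have "dF (Suc i) (f - \<theta> (Suc i) h') = 0"
    using e theta_Suc[OF h'(1)] h'(2) by (simp add: F.D.diff) (metis add_right_cancel)
  moreover have "f - \<theta> (Suc i) h' \<in> free_mod (bF (Suc i))"
    by (intro vec.subspace_diff[OF subspace_free_mod] theta_free fh h')
  ultimately obtain f' where f': "f' \<in> free_mod (bF (Suc (Suc i)))"
      "dF (Suc (Suc i)) f' = f - \<theta> (Suc i) h'"
    using F.d_exact by blast
  have "dG (Suc (Suc i)) (pair (Suc (Suc i)) f' h') = g"
    by (simp add: dG_pair[OF f'(1)] f' h' fh)
  then show "g \<in> dG (Suc (Suc i)) ` free_mod (bG (Suc (Suc i)))"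
    using pair_in_free[OF f'(1) h'(1)] by blast
qed

lemma horseshoe: "min_res m sP bG dG eG"
proof
  show "ideal m" by (rule F.ideal_m)
  have min: "dG i ` free_mod (bG i) \<subseteq> ideal_free m (bG (i - 1))" if "i \<ge> 1" for i
    using that dG_filt_0[of _ "i - 1"] by (auto simp: ideal_power_1[OF F.ideal_m])
  have "dG (Suc i) ` free_mod (bG (Suc i)) = {g \<in> free_mod (bG i). dG i g = 0}" if "i \<ge> 1" for i
    using that dG_exact[of "i - 1"] by simp
  moreover have "module_hom vscale vscale (dG i)" if "i \<ge> 1" for i
    using that dG_hom[of "i - 1"] by simp
  ultimately show "minimal_free_resolution m sP bG dG eG"
    unfolding minimal_free_resolution_def free_resolution_def
    using min eG_hom eG_surj eG_exact
    by (auto simp: ideal_smult_free_mod[OF F.ideal_m] ideal_free_def subset_iff)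
qed

end

context koszul_extension
begin

sublocale G: min_res m sP bG dG eG
  by (rule horseshoe)

subsection \<open>The long exact sequence of the linear parts\<close>

lemma pair_cycle_iff:
  assumes "f \<in> F.F j (Suc i)" "h \<in> H.F j (Suc i)"
  shows "dG (Suc i) (pair (Suc i) f h) \<in> G.F k i
    \<longleftrightarrow> dF (Suc i) f + \<theta> i h \<in> F.F k i \<and> dH (Suc i) h \<in> H.F k i"
proof -
  have "dF (Suc i) f + \<theta> i h \<in> free_mod (bF i)"
    by (intro vec.subspace_add[OF subspace_free_mod] F.d_free theta_free F.F_free[OF assms(1)]
        H.F_free[OF assms(2)])
  then show ?thesis
    by (simp add: dG_pair[OF F.F_free[OF assms(1)]] pair_filt_iff H.d_free[OF H.F_free[OF assms(2)]])
qed

text \<open>Exactness of \<open>H\<^sub>i(lin F) \<rightarrow> H\<^sub>i(lin G) \<rightarrow> H\<^sub>i(lin H)\<close> in the middle, for \<open>i \<ge> 1\<close>.\<close>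

lemma lin_acyclic_middle:
  assumes "lin_acyclic m bH dH i"
  shows "lin_acyclic m bG dG i"
  unfolding lin_acyclic_def
proof (intro allI ballI impI)
  fix j g
  assume g: "g \<in> G.F j (Suc i)" and dg: "dG (Suc i) g \<in> G.F (j + 2) i"
  obtain f h where fh: "f \<in> F.F j (Suc i)" "h \<in> H.F j (Suc i)" "g = pair (Suc i) f h"
    using g by (rule pairE_filt)
  have d: "dF (Suc i) f + \<theta> i h \<in> F.F (j + 2) i" "dH (Suc i) h \<in> H.F (j + 2) i"
    using dg pair_cycle_iff[OF fh(1,2)] by (simp_all add: fh(3))
  obtain h' where h': "h' \<in> H.F (j - 1) (Suc (Suc i))"
      "h - dH (Suc (Suc i)) h' \<in> H.F (Suc j) (Suc i)"
    using assms[unfolded lin_acyclic_def, rule_format, OF fh(2) d(2)] by blast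
  let ?f = "f - \<theta> (Suc i) h'" and ?h = "h - dH (Suc (Suc i)) h'"
  have "\<theta> (Suc i) h' \<in> F.F j (Suc i)"
    using F.F_antimono[OF theta_filt[OF h'(1)]] by simp
  then have f: "?f \<in> F.F j (Suc i)" by (rule F.F_diff[OF fh(1)])
  have "dF (Suc i) ?f = (dF (Suc i) f + \<theta> i h) - \<theta> i ?h"
    using theta_Suc[OF H.F_free[OF h'(1)]] by (simp add: F.D.diff \<theta>.diff eq_neg_iff_add_eq_0[symmetric])
  moreover have "\<theta> i ?h \<in> F.F (j + 2) i"
    using theta_filt[OF h'(2)] by simp
  ultimately have "dF (Suc i) ?f \<in> F.F (j + 2) i"
    using F.F_diff[OF d(1)] by simp
  then obtain f' where f': "f' \<in> F.F (j - 1) (Suc (Suc i))"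
      "?f - dF (Suc (Suc i)) f' \<in> F.F (Suc j) (Suc i)"
    using koszul[of i, unfolded lin_acyclic_def, rule_format, OF f] by blast
  have "g - dG (Suc (Suc i)) (pair (Suc (Suc i)) f' h') = pair (Suc i) (?f - dF (Suc (Suc i)) f') ?h"
    by (simp only: fh(3) dG_pair[OF F.F_free[OF f'(1)]] pair_diff) (simp add: algebra_simps)
  also have "\<dots> \<in> G.F (Suc j) (Suc i)"
    using f'(2) h'(2) by (simp only: pair_filt_iff[OF F.F_free[OF f'(2)] H.F_free[OF h'(2)]])
  finally show "\<exists>z \<in> G.F (j - 1) (Suc (Suc i)). g - dG (Suc (Suc i)) z \<in> G.F (Suc j) (Suc i)"
    using pair_filt_iff[OF F.F_free[OF f'(1)] H.F_free[OF h'(1)]] f'(1) h'(1) by blast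
qed

text \<open>A cycle of the linear part of \<open>H\<close> is a boundary once it lifts to a cycle of the linear part of \<open>G\<close>.\<close>

lemma lin_boundary_if_lifts:
  assumes G: "lin_acyclic m bG dG i"
    and h: "h \<in> H.F j (Suc i)" "dH (Suc i) h \<in> H.F (j + 2) i"
    and f: "f \<in> F.F j (Suc i)" "dF (Suc i) f + \<theta> i h \<in> F.F (j + 2) i"
  shows "\<exists>z \<in> H.F (j - 1) (Suc (Suc i)). h - dH (Suc (Suc i)) z \<in> H.F (Suc j) (Suc i)"
proof -
  have "pair (Suc i) f h \<in> G.F j (Suc i)"
    using f h pair_filt_iff[OF F.F_free[OF f(1)] H.F_free[OF h(1)]] by blast
  moreover have "dG (Suc i) (pair (Suc i) f h) \<in> G.F (j + 2) i"
    using pair_cycle_iff[OF f(1) h(1)] f h by blast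
  ultimately obtain g where g: "g \<in> G.F (j - 1) (Suc (Suc i))"
      "pair (Suc i) f h - dG (Suc (Suc i)) g \<in> G.F (Suc j) (Suc i)"
    using G[unfolded lin_acyclic_def, rule_format] by blast
  obtain f' h' where fh: "f' \<in> F.F (j - 1) (Suc (Suc i))" "h' \<in> H.F (j - 1) (Suc (Suc i))"
      "g = pair (Suc (Suc i)) f' h'"
    using g(1) by (rule pairE_filt)
  have fr: "f - (dF (Suc (Suc i)) f' + \<theta> (Suc i) h') \<in> free_mod (bF (Suc i))"
    by (intro vec.subspace_diff[OF subspace_free_mod] vec.subspace_add[OF subspace_free_mod] F.d_free
        theta_free F.F_free[OF fh(1)] H.F_free[OF fh(2)] F.F_free[OF f(1)])
  have hr: "h - dH (Suc (Suc i)) h' \<in> free_mod (bH (Suc i))"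
    by (intro vec.subspace_diff[OF subspace_free_mod] H.d_free H.F_free[OF fh(2)] H.F_free[OF h(1)])
  have "h - dH (Suc (Suc i)) h' \<in> H.F (Suc j) (Suc i)"
    using g(2) unfolding fh(3) dG_pair[OF F.F_free[OF fh(1)]] pair_diff pair_filt_iff[OF fr hr] ..
  then show ?thesis using fh(2) by blast
qed

text \<open>Exactness of \<open>H\<^sub>i(lin G) \<rightarrow> H\<^sub>i(lin H) \<rightarrow> H\<^sub>i\<^sub>-\<^sub>1(lin F) = 0\<close> for \<open>i \<ge> 2\<close>. The connecting map sends the class of
  \<open>h\<close> to that of \<open>\<theta> h\<close>; where this is a boundary, \<open>h\<close> lifts to a cycle of the linear part of \<open>G\<close>.\<close>

lemma lin_acyclic_quotient:
  assumes "lin_acyclic m bG dG (Suc i)"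
  shows "lin_acyclic m bH dH (Suc i)"
  unfolding lin_acyclic_def
proof (intro allI ballI impI)
  fix j h
  assume h: "h \<in> H.F j (Suc (Suc i))" and dh: "dH (Suc (Suc i)) h \<in> H.F (j + 2) (Suc i)"
  have t: "\<theta> (Suc i) h \<in> F.F (Suc j) (Suc i)" by (rule theta_filt[OF h])
  have "dF (Suc i) (\<theta> (Suc i) h) = - \<theta> i (dH (Suc (Suc i)) h)"
    using theta_Suc[OF H.F_free[OF h]] by (simp add: eq_neg_iff_add_eq_0)
  then have "dF (Suc i) (\<theta> (Suc i) h) \<in> F.F (Suc j + 2) i"
    using F.F_neg[OF theta_filt[OF dh]] by simp
  then obtain f where f: "f \<in> F.F (Suc j - 1) (Suc (Suc i))"
      "\<theta> (Suc i) h - dF (Suc (Suc i)) f \<in> F.F (Suc (Suc j)) (Suc i)"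
    using koszul[of i, unfolded lin_acyclic_def, rule_format, OF t] by blast
  have "dF (Suc (Suc i)) (- f) + \<theta> (Suc i) h = \<theta> (Suc i) h - dF (Suc (Suc i)) f"
    by (simp only: F.D.neg add.commute[of _ "\<theta> (Suc i) h"] diff_conv_add_uminus)
  then have "dF (Suc (Suc i)) (- f) + \<theta> (Suc i) h \<in> F.F (j + 2) (Suc i)"
    using f(2) by simp
  moreover have "- f \<in> F.F j (Suc (Suc i))" using F.F_neg f(1) by simp
  ultimately show "\<exists>z \<in> H.F (j - 1) (Suc (Suc (Suc i))).
      h - dH (Suc (Suc (Suc i))) z \<in> H.F (Suc j) (Suc (Suc i))"
    by (intro lin_boundary_if_lifts[OF assms h dh])
qed

text \<open>In position 1 the connecting map takes values in \<open>H\<^sub>0(lin F) = gr M\<close>, more precisely in the kernel of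
  \<open>gr M \<rightarrow> gr P\<close>: the image of \<open>\<theta> h\<close> in \<open>P\<close> is \<open>- \<mu> (d h)\<close>, which lies one step deeper than \<open>\<theta> h\<close> does. Strictness of
  \<open>M \<rightarrow> P\<close> makes this kernel zero.\<close>

lemma lin_acyclic_quotient_0:
  assumes G: "lin_acyclic m bG dG 0"
    and strict: "\<And>k x. \<phi> x \<in> ideal_smult sP (ideal_power m k) UNIV
      \<Longrightarrow> x \<in> ideal_smult sM (ideal_power m k) UNIV"
  shows "lin_acyclic m bH dH 0"
  unfolding lin_acyclic_def
proof (intro allI ballI impI)
  fix j h
  assume h: "h \<in> H.F j (Suc 0)" and dh: "dH (Suc 0) h \<in> H.F (j + 2) 0"
  let ?t = "\<theta> 0 h"
  have t: "?t \<in> F.F (Suc j) 0" by (rule theta_filt[OF h])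
  have "\<mu> ` H.F (j + 2) 0 \<subseteq> ideal_smult sP (ideal_power m (j + 2)) UNIV"
    unfolding image_ideal_free[OF mu_hom ideal_power_ideal]
    unfolding ideal_smult_def by (intro \<phi>.m2.span_mono) blast
  then have "- \<mu> (dH (Suc 0) h) \<in> ideal_smult sP (ideal_power m (j + 2)) UNIV"
    using dh by (intro \<phi>.m2.subspace_neg[OF subspace_ideal_smult[OF \<phi>.m2.module_axioms]]) blast
  moreover have "\<phi> (eM ?t) = - \<mu> (dH (Suc 0) h)"
    using theta_0[OF H.F_free[OF h]] by (simp add: eq_neg_iff_add_eq_0)
  ultimately have "eM ?t \<in> ideal_smult sM (ideal_power m (j + 2)) UNIV"
    by (intro strict) simp
  then obtain f' where f': "f' \<in> F.F (j + 2) 0" "eM f' = eM ?t"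
    unfolding F.e_filt[symmetric] by auto
  have k: "?t - f' \<in> F.F (Suc j) 0"
    using F.F_antimono[OF f'(1)] by (intro F.F_diff[OF t]) simp
  have "eM (?t - f') = 0" by (simp add: F.E.diff f'(2))
  then obtain f0 where f0: "f0 \<in> free_mod (bF (Suc 0))" "dF (Suc 0) f0 = ?t - f'"
    using F.e_exact[OF F.F_free[OF k]] by blast
  obtain f where f: "f \<in> F.F j (Suc 0)" "dF (Suc 0) f = ?t - f'"
    using F.lin_acyclic_strict[OF koszul[of 0] f0(1)] k f0(2) by metis
  have "dF (Suc 0) (- f) + ?t = f'"
    by (simp only: F.D.neg f(2)) simp
  then have "dF (Suc 0) (- f) + ?t \<in> F.F (j + 2) 0" using f'(1) by simp
  then show "\<exists>z \<in> H.F (j - 1) (Suc (Suc 0)). h - dH (Suc (Suc 0)) z \<in> H.F (Suc j) (Suc 0)"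
    by (intro lin_boundary_if_lifts[OF G h dh F.F_neg[OF f(1)]])
qed

text \<open>Conversely, if \<open>H\<^sub>1(lin H) = 0\<close> then \<open>gr M \<rightarrow> gr P\<close> is injective.\<close>

lemma adic_strict:
  assumes H: "lin_acyclic m bH dH 0"
  shows "\<phi> x \<in> ideal_smult sP (ideal_power m k) UNIV \<Longrightarrow> x \<in> ideal_smult sM (ideal_power m k) UNIV"
proof (induction k)
  case 0
  obtain f where "f \<in> free_mod (bF 0)" "eM f = x"
    using F.e_surj by (metis UNIV_I imageE)
  then show ?case unfolding F.e_filt[symmetric] by (auto simp: ideal_free_def)
next
  case (Suc k)
  obtain g where g: "g \<in> G.F (Suc k) 0" "eG g = \<phi> x"
    using Suc.prems unfolding G.e_filt[symmetric] by auto
  obtain f h where fh: "f \<in> F.F (Suc k) 0" "h \<in> H.F (Suc k) 0" "g = pair 0 f h"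
    using g(1) by (rule pairE_filt)
  obtain f0 where f0: "f0 \<in> free_mod (bF 0)" "eM f0 = x"
    using F.e_surj by (metis UNIV_I imageE)
  \<comment> \<open>\<open>g = (f, h)\<close> and \<open>(f0, 0)\<close> both lie over \<open>\<phi> x\<close>, so \<open>h\<close> is a boundary. Strictness of \<open>d\<close> on \<open>H\<close> gives it a
      preimage \<open>h1\<close> in \<open>m\<^sup>kH\<close>, and \<open>f - \<theta> h1\<close> is a lift of \<open>x\<close> in \<open>m\<^sup>k\<^sup>+\<^sup>1F\<close>.\<close>
  have "\<phi> (eM (f - f0)) + \<mu> h = 0"
    using g(2) by (simp add: fh(3) eG_pair[OF F.F_free[OF fh(1)]] F.E.diff \<phi>.diff f0(2) algebra_simps)
  have "eN h = 0"
    by (rule mu_free_0[OF _ H.F_free[OF fh(2)] \<open>_ = 0\<close>])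
       (intro vec.subspace_diff[OF subspace_free_mod] F.F_free[OF fh(1)] f0(1))
  then obtain h0 where h0: "h0 \<in> free_mod (bH (Suc 0))" "dH (Suc 0) h0 = h"
    using H.e_exact[OF H.F_free[OF fh(2)]] by blast
  obtain h1 where h1: "h1 \<in> H.F k (Suc 0)" "dH (Suc 0) h1 = h"
    using H.lin_acyclic_strict[OF H h0(1)] fh(2) h0(2) by metis
  have "\<phi> (eM (f - \<theta> 0 h1)) = \<phi> x"
    using \<open>\<phi> _ + \<mu> h = 0\<close> theta_0[OF H.F_free[OF h1(1)]] f0(2) h1(2)
    by (simp add: F.E.diff \<phi>.diff) (metis add_right_cancel add_uminus_conv_diff diff_add_cancel diff_add_eq eq_iff_diff_eq_0)
  then have "eM (f - \<theta> 0 h1) = x" using inj_\<phi> by (meson injD)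
  moreover have "f - \<theta> 0 h1 \<in> F.F (Suc k) 0"
    by (rule F.F_diff[OF fh(1) theta_filt[OF h1(1)]])
  ultimately show ?case unfolding F.e_filt[symmetric] by blast
qed

end

lemma koszul_extension_exists:
  assumes "min_res m sM bF dF eM" "min_res m sN bH dH eN" "short_exact sM sP sN \<phi> \<psi>"
    and "range \<phi> \<inter> ideal_smult sP m UNIV = ideal_smult sP m (range \<phi>)"
    and "\<And>i. lin_acyclic m bF dF i"
  obtains \<mu> \<theta> where "koszul_extension m sM bF dF eM sN bH dH eN sP \<phi> \<psi> \<mu> \<theta>"
proof -
  interpret F: min_res m sM bF dF eM by fact
  interpret H: min_res m sN bH dH eN by fact
  interpret \<phi>: module_hom sM sP \<phi> using assms(3) by (simp add: short_exact_def)
  interpret \<psi>: module_hom sP sN \<psi> using assms(3) by (simp add: short_exact_def)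
  have ex: "inj \<phi>" "range \<phi> = {x. \<psi> x = 0}" "surj \<psi>"
    using assms(3) by (simp_all add: short_exact_def)
  obtain \<mu> where \<mu>: "module_hom vscale sP \<mu>" "\<And>h. h \<in> free_mod (bH 0) \<Longrightarrow> \<psi> (\<mu> h) = eN h"
    using free_mod_lift[OF H.e_hom \<psi>.module_hom_axioms \<phi>.m2.subspace_UNIV, of "bH 0"] ex(3) by auto
  interpret \<mu>: module_hom vscale sP \<mu> by (rule \<mu>)
  interpret pr: module_pair "vscale :: _ \<Rightarrow> (nat \<Rightarrow> _) \<Rightarrow> _" sP ..
  have u: "module_hom vscale sP (\<lambda>h. - \<mu> (dH (Suc 0) h))"
    by (intro pr.module_hom_neg module_hom_compose[OF H.d_hom \<mu>(1), unfolded o_def])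
  have v: "module_hom vscale sP (\<lambda>f. \<phi> (eM f))"
    by (rule module_hom_compose[OF F.e_hom \<phi>.module_hom_axioms, unfolded o_def])
  have img: "- \<mu> (dH (Suc 0) h) \<in> (\<lambda>f. \<phi> (eM f)) ` free_mod (bF 0)" if h: "h \<in> free_mod (bH (Suc 0))" for h
  proof -
    have "\<psi> (- \<mu> (dH (Suc 0) h)) = 0"
      by (simp add: \<psi>.neg \<mu>(2)[OF H.d_free[OF h]] H.e_d[OF h])
    then have "- \<mu> (dH (Suc 0) h) \<in> \<phi> ` (eM ` free_mod (bF 0))"
      unfolding F.e_surj ex(2) by simp
    then show ?thesis by (simp add: image_image)
  qed
  obtain \<theta>0 where \<theta>0: "module_hom vscale vscale \<theta>0" "\<And>h. \<theta>0 h \<in> free_mod (bF 0)"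
      "\<And>h. h \<in> free_mod (bH (Suc 0)) \<Longrightarrow> \<phi> (eM (\<theta>0 h)) = - \<mu> (dH (Suc 0) h)"
    using free_mod_lift[OF u v subspace_free_mod[of "bF 0"] img[OF unit_vec_free]] by blast
  have init: "- \<theta>0 (dH (Suc (Suc 0)) h) \<in> dF (Suc 0) ` free_mod (bF (Suc 0))"
    if h: "h \<in> free_mod (bH (Suc (Suc 0)))" for h
  proof -
    have "\<phi> (eM (\<theta>0 (dH (Suc (Suc 0)) h))) = \<phi> 0"
      by (simp add: \<theta>0(3)[OF H.d_free[OF h]] H.d_d[OF h])
    then have "eM (\<theta>0 (dH (Suc (Suc 0)) h)) = 0" using ex(1) by (meson injD)
    then have "eM (- \<theta>0 (dH (Suc (Suc 0)) h)) = 0" by (simp only: F.E.neg neg_equal_0_iff_equal)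
    then show ?thesis
      unfolding F.d_image_0 using vec.subspace_neg[OF subspace_free_mod \<theta>0(2)] by blast
  qed
  obtain \<theta> where \<theta>: "\<theta> 0 = \<theta>0" "\<And>i. module_hom vscale vscale (\<theta> i)"
      "\<And>i h. h \<in> free_mod (bH (Suc i)) \<Longrightarrow> \<theta> i h \<in> free_mod (bF i)"
      "\<And>i h. h \<in> free_mod (bH (Suc (Suc i)))
        \<Longrightarrow> dF (Suc i) (\<theta> (Suc i) h) = 0 + vscale (- 1) (\<theta> i (dH (Suc (Suc i)) h))"
    by (rule chain_lift[where dC = "\<lambda>i. dH (Suc i)" and bC = "\<lambda>i. bH (Suc i)" and dD = dF and bD = bF
          and \<gamma> = "\<lambda>_ _. 0" and c = "- 1" and ?h0.0 = \<theta>0])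
      (auto simp: H.d_free H.d_d H.d_hom F.d_hom F.d_exact \<theta>0 vec_pair.module_hom_zero F.D.zero
        vec.subspace_0[OF subspace_free_mod] init)
  have \<theta>_Suc: "dF (Suc i) (\<theta> (Suc i) h) + \<theta> i (dH (Suc (Suc i)) h) = 0"
    if "h \<in> free_mod (bH (Suc (Suc i)))" for i h
    using \<theta>(4)[OF that] by simp
  have \<theta>_0: "\<phi> (eM (\<theta> 0 h)) + \<mu> (dH (Suc 0) h) = 0" if "h \<in> free_mod (bH (Suc 0))" for h
    by (simp add: \<theta>(1) \<theta>0(3)[OF that])
  have "koszul_extension m sM bF dF eM sN bH dH eN sP \<phi> \<psi> \<mu> \<theta>"
    by (intro koszul_extension.intro koszul_extension_axioms.intro)
       (fact assms \<mu> \<theta>(2,3) \<theta>_0 \<theta>_Suc)+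
  then show thesis by (rule that)
qed

text \<open>The common core of the local and the graded case, in terms of given minimal resolutions.\<close>

lemma lin_sup_of_extension:
  assumes M: "min_res m sM bF dF eM" and N: "min_res m sN bH dH eN" and P: "min_res m sP b d e"
    and exact: "short_exact sM sP sN \<phi> \<psi>"
    and cond: "range \<phi> \<inter> ideal_smult sP m UNIV = ideal_smult sP m (range \<phi>)"
    and koszul: "lin_sup m bF dF = 0"
  shows "lin_sup m b d \<le> lin_sup m bH dH"
    and "lin_sup m bH dH \<le> max (lin_sup m b d) 1"
    and "lin_sup m bH dH = 0 \<longleftrightarrow> lin_sup m b d = 0 \<and>
      (\<forall>k\<ge>1. range \<phi> \<inter> ideal_smult sP (ideal_power m k) UNIV
          = ideal_smult sP (ideal_power m k) (range \<phi>))"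
proof -
  have "lin_acyclic m bF dF i" for i
    using koszul by (simp add: min_res.lin_sup_0_iff[OF M])
  then obtain \<mu> \<theta> where "koszul_extension m sM bF dF eM sN bH dH eN sP \<phi> \<psi> \<mu> \<theta>"
    using koszul_extension_exists[OF M N exact cond] by blast
  then interpret koszul_extension m sM bF dF eM sN bH dH eN sP \<phi> \<psi> \<mu> \<theta> .
  have b: "lin_sup m b d = lin_sup m bG dG"
    by (rule lin_sup_unique[OF P horseshoe])
  have le: "lin_sup m bG dG \<le> enat k" if "lin_sup m bH dH \<le> enat k" for k
    using that lin_acyclic_middle unfolding G.lin_sup_le_iff H.lin_sup_le_iff by blast
  then show "lin_sup m b d \<le> lin_sup m bH dH"
    unfolding b by (metis enat_ord_code(3) enat.exhaust order_refl)
  have H_le: "lin_sup m bH dH \<le> enat (max k 1)" if "lin_sup m bG dG \<le> enat k" for k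
    unfolding H.lin_sup_le_iff
  proof (intro allI impI)
    fix i assume "max k 1 \<le> i"
    then show "lin_acyclic m bH dH i"
      using that lin_acyclic_quotient[of "i - 1"] by (simp add: G.lin_sup_le_iff)
  qed
  show "lin_sup m bH dH \<le> max (lin_sup m b d) 1"
  proof (cases "lin_sup m bG dG")
    case (enat k)
    then have "enat (max k 1) = max (lin_sup m bG dG) 1"
      by (simp add: one_enat_def max_def)
    then show ?thesis using H_le[of k] enat by (simp add: b)
  qed (simp add: b)
  have sub: "ideal_smult sP (ideal_power m k) (range \<phi>) \<subseteq> range \<phi> \<inter> ideal_smult sP (ideal_power m k) UNIV" for k
  proof (rule Int_greatest)
    show "ideal_smult sP (ideal_power m k) (range \<phi>) \<subseteq> range \<phi>"
      unfolding ideal_smult_image[OF \<phi>.module_hom_axioms] by blast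
    show "ideal_smult sP (ideal_power m k) (range \<phi>) \<subseteq> ideal_smult sP (ideal_power m k) UNIV"
      unfolding ideal_smult_def by (intro \<phi>.m2.span_mono) blast
  qed
  have strict_iff: "range \<phi> \<inter> ideal_smult sP (ideal_power m k) UNIV
        = ideal_smult sP (ideal_power m k) (range \<phi>)
      \<longleftrightarrow> (\<forall>x. \<phi> x \<in> ideal_smult sP (ideal_power m k) UNIV \<longrightarrow> x \<in> ideal_smult sM (ideal_power m k) UNIV)"
    for k
    unfolding phi_filt_iff[symmetric] using sub[of k] by blast
  have mk0: "x \<in> ideal_smult sM (ideal_power m 0) UNIV" for x
    unfolding F.e_filt[symmetric] ideal_free_UNIV F.e_surj by simp
  show "lin_sup m bH dH = 0 \<longleftrightarrow> lin_sup m b d = 0 \<and>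
      (\<forall>k\<ge>1. range \<phi> \<inter> ideal_smult sP (ideal_power m k) UNIV
          = ideal_smult sP (ideal_power m k) (range \<phi>))"
  proof (intro iffI conjI)
    assume H: "lin_sup m bH dH = 0"
    then show "lin_sup m b d = 0"
      using le[of 0] unfolding b by (simp add: zero_enat_def[symmetric])
    show "\<forall>k\<ge>1. range \<phi> \<inter> ideal_smult sP (ideal_power m k) UNIV
          = ideal_smult sP (ideal_power m k) (range \<phi>)"
      unfolding strict_iff using adic_strict H by (simp add: H.lin_sup_0_iff)
  next
    assume "lin_sup m b d = 0 \<and>
      (\<forall>k\<ge>1. range \<phi> \<inter> ideal_smult sP (ideal_power m k) UNIV
          = ideal_smult sP (ideal_power m k) (range \<phi>))"
    then have G: "\<And>i. lin_acyclic m bG dG i"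
      and S: "\<And>k x. k \<ge> 1 \<Longrightarrow> \<phi> x \<in> ideal_smult sP (ideal_power m k) UNIV
          \<Longrightarrow> x \<in> ideal_smult sM (ideal_power m k) UNIV"
      unfolding b strict_iff by (auto simp: G.lin_sup_0_iff)
    have "lin_acyclic m bH dH 0"
      using lin_acyclic_quotient_0[OF G] S mk0 by (metis less_one not_le)
    moreover have "lin_acyclic m bH dH (Suc i)" for i
      by (rule lin_acyclic_quotient[OF G])
    ultimately show "lin_sup m bH dH = 0"
      unfolding H.lin_sup_0_iff by (metis not0_implies_Suc)
  qed
qed

section \<open>Existence of minimal resolutions\<close>

text \<open>By induction on the rank, splitting off the ideal of last coordinates.\<close>

lemma noetherian_free_mod:
  fixes K :: "(nat \<Rightarrow> 'r::comm_ring_1) set"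
  assumes noeth: "noetherian TYPE('r)"
  shows "vec.subspace K \<Longrightarrow> K \<subseteq> free_mod r \<Longrightarrow> \<exists>S. finite S \<and> vec.span S = K"
proof (induction r arbitrary: K)
  case 0
  then have "K = {0}" using vec.subspace_0 by (fastforce simp: free_mod_def)
  then show ?case using vec.span_empty by (intro exI[of _ "{}"]) auto
next
  case (Suc r)
  interpret ev: module_hom vscale "(*)" "\<lambda>x :: nat \<Rightarrow> 'r. x r"
    by unfold_locales (auto simp: vscale_def)
  obtain T where T: "finite T" "(\<lambda>x. x r) ` K = ring.span T"
    using noeth[unfolded noetherian_def, rule_format, OF ev.subspace_image[OF Suc.prems(1)]] by blast
  have "t \<in> (\<lambda>x. x r) ` K" if "t \<in> T" for t
    unfolding T(2) by (rule ring.span_base[OF that])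
  then have "\<forall>t \<in> T. \<exists>y. y \<in> K \<and> y r = t" by (auto simp: image_iff eq_commute)
  then obtain y where y: "\<And>t. t \<in> T \<Longrightarrow> y t \<in> K \<and> y t r = t" by metis
  obtain S where S: "finite S" "vec.span S = K \<inter> free_mod r"
    using Suc.IH[OF vec.subspace_inter[OF Suc.prems(1) subspace_free_mod]] by blast
  have "vec.span (S \<union> y ` T) = K"
  proof
    show "vec.span (S \<union> y ` T) \<subseteq> K"
      using y S(2) vec.span_superset[of S] by (intro vec.span_minimal[OF _ Suc.prems(1)]) auto
    show "K \<subseteq> vec.span (S \<union> y ` T)"
    proof
      fix x assume x: "x \<in> K"
      have "(\<lambda>x. x r) ` y ` T = T" using y by (simp add: image_image cong: image_cong_simp)
      then have "x r \<in> (\<lambda>x. x r) ` vec.span (y ` T)"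
        unfolding ev.span_image[symmetric] using x T(2) by auto
      then obtain w where w: "w \<in> vec.span (y ` T)" "x r = w r" by blast
      have "w \<in> K"
        using w(1) vec.span_minimal[OF _ Suc.prems(1), of "y ` T"] y by blast
      then have "x - w \<in> K" by (rule vec.subspace_diff[OF Suc.prems(1) x])
      moreover have "(x - w) k = 0" if "k \<ge> r" for k
        using \<open>x - w \<in> K\<close> Suc.prems(2) w(2) that
        by (cases "k = r") (auto simp: free_mod_def subset_iff)
      ultimately have "x - w \<in> vec.span S" unfolding S(2) free_mod_def by blast
      then have "x - w \<in> vec.span (S \<union> y ` T)" "w \<in> vec.span (S \<union> y ` T)"
        using w(1) vec.span_mono[of S "S \<union> y ` T"] vec.span_mono[of "y ` T" "S \<union> y ` T"] by blast+
      then have "x - w + w \<in> vec.span (S \<union> y ` T)" by (rule vec.span_add)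
      then show "x \<in> vec.span (S \<union> y ` T)" by simp
    qed
  qed
  then show ?case using S(1) T(1) by (intro exI[of _ "S \<union> y ` T"]) simp
qed

text \<open>Covers by free modules with kernel in \<open>mF\<close> are spliced together by dependent choice. The parameter \<open>t\<close> is a
  decoration of the free modules, trivial for local rings and consisting of the twists for graded ones; \<open>good\<close> is the
  property of kernels that allows the next cover.\<close>

lemma minimal_resolution_exists:
  fixes good :: "nat \<Rightarrow> 't \<Rightarrow> (nat \<Rightarrow> 'r::comm_ring_1) set \<Rightarrow> bool"
  assumes ideal: "ideal m"
    and start: "module_hom vscale s e" "e ` free_mod b0 = UNIV" "good b0 t0 {x \<in> free_mod b0. e x = 0}"
    and good: "\<And>b t K. good b t K \<Longrightarrow> K \<subseteq> ideal_free m b"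
    and step: "\<And>b t K. good b t K \<Longrightarrow> \<exists>b' t' d. module_hom vscale vscale d \<and> d ` free_mod b' = K
        \<and> good b' t' {x \<in> free_mod b'. d x = 0} \<and> linked b' t' b t d"
  obtains b t d where "minimal_free_resolution m s b d e" "b 0 = b0" "t 0 = t0"
    "\<And>i. linked (b (Suc i)) (t (Suc i)) (b i) (t i) (d (Suc i))"
proof -
  define P where "P n = (\<lambda>(b, t, K, d :: (nat \<Rightarrow> 'r) \<Rightarrow> nat \<Rightarrow> 'r). good b t K
      \<and> (n = 0 \<longrightarrow> b = b0 \<and> t = t0 \<and> K = {x \<in> free_mod b0. e x = 0}))" for n :: nat
  define Q where "Q n = (\<lambda>(b, t, K, d :: (nat \<Rightarrow> 'r) \<Rightarrow> nat \<Rightarrow> 'r) (b', t', K', d').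
      module_hom vscale vscale d' \<and> d' ` free_mod b' = K \<and> K' = {x \<in> free_mod b'. d' x = 0}
      \<and> linked b' t' b t d')" for n :: nat
  have "\<exists>f. \<forall>n. P n (f n) \<and> Q n (f n) (f (Suc n))"
  proof (rule dependent_nat_choice)
    show "\<exists>x. P 0 x" using start(3) by (auto simp: P_def)
    show "\<exists>y. P (Suc n) y \<and> Q n x y" if Px: "P n x" for x n
    proof -
      obtain b t K d where x: "x = (b, t, K, d)" by (cases x)
      then have "good b t K" using Px by (simp add: P_def)
      then obtain b' t' d' where "module_hom vscale vscale d'" "d' ` free_mod b' = K"
          "good b' t' {x \<in> free_mod b'. d' x = 0}" "linked b' t' b t d'"
        using step by blast
      then show ?thesis
        by (intro exI[of _ "(b', t', {x \<in> free_mod b'. d' x = 0}, d')"]) (simp add: P_def Q_def x)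
    qed
  qed
  then obtain f where f: "\<And>n. P n (f n)" "\<And>n. Q n (f n) (f (Suc n))" by blast
  define b where "b n = fst (f n)" for n
  define t where "t n = fst (snd (f n))" for n
  define K where "K n = fst (snd (snd (f n)))" for n
  define d where "d n = snd (snd (snd (f n)))" for n
  have f_eq: "f n = (b n, t n, K n, d n)" for n by (simp add: b_def t_def K_def d_def)
  have K: "K n \<subseteq> ideal_free m (b n)" for n
    using f(1)[of n] good[of "b n" "t n" "K n"] by (simp add: f_eq P_def)
  have init: "b 0 = b0" "t 0 = t0" "K 0 = {x \<in> free_mod b0. e x = 0}"
    using f(1)[of 0] by (simp_all add: f_eq P_def)
  have d: "module_hom vscale vscale (d (Suc n))" "d (Suc n) ` free_mod (b (Suc n)) = K n"
      "K (Suc n) = {x \<in> free_mod (b (Suc n)). d (Suc n) x = 0}"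
      "linked (b (Suc n)) (t (Suc n)) (b n) (t n) (d (Suc n))" for n
    using f(2)[of n] by (simp_all add: f_eq Q_def)
  have d': "module_hom vscale vscale (d i)" "d i ` free_mod (b i) \<subseteq> ideal_free m (b (i - 1))"
      "d (Suc i) ` free_mod (b (Suc i)) = {x \<in> free_mod (b i). d i x = 0}" if "i \<ge> 1" for i
    using that d(1)[of "i - 1"] d(2)[of "i - 1"] d(3)[of "i - 1"] d(2)[of i] K[of "i - 1"] by simp_all
  have "minimal_free_resolution m s b d e"
    unfolding minimal_free_resolution_def free_resolution_def
    using start(1,2) d' d(2)[of 0] init
    by (auto simp: ideal_smult_free_mod[OF ideal] ideal_free_def subset_iff)
  then show thesis using that init(1,2) d(4) by blast
qed

text \<open>A shortest generating list drawn from \<open>H\<close> has no redundant entry, hence no relation with a unit coefficient.\<close>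

lemma irredundant_generators:
  assumes "module s" "finite T" "T \<subseteq> H" "module.span s T = K"
  obtains r :: nat and g where "g ` {..<r} \<subseteq> H" "module.span s (g ` {..<r}) = K"
    "\<And>x j c. (\<Sum>l<r. s (x l) (g l)) = 0 \<Longrightarrow> j < r \<Longrightarrow> c * x j \<noteq> 1"
proof -
  interpret module s by fact
  define Gen where "Gen S \<longleftrightarrow> finite S \<and> S \<subseteq> H \<and> span S = K" for S
  obtain S where S: "Gen S" "\<And>S'. Gen S' \<Longrightarrow> card S \<le> card S'"
    using ex_has_least_nat[of Gen T card] assms by (auto simp: Gen_def)
  define r where "r = card S"
  obtain g where g: "bij_betw g {..<r} S"
    using ex_bij_betw_nat_finite[of S] S(1) by (auto simp: Gen_def r_def atLeast0LessThan)
  then have gS: "g ` {..<r} = S" by (simp add: bij_betw_def)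
  show thesis
  proof
    show "g ` {..<r} \<subseteq> H" "span (g ` {..<r}) = K"
      using S(1) by (simp_all add: gS Gen_def)
    fix x j c
    assume rel: "(\<Sum>l<r. s (x l) (g l)) = 0" and j: "j < r"
    show "c * x j \<noteq> 1"
    proof
      assume c: "c * x j = 1"
      have gj: "g j \<in> S" using gS j by blast
      have "(\<Sum>l<r. s (x l) (g l)) = s (x j) (g j) + (\<Sum>l\<in>{..<r} - {j}. s (x l) (g l))"
        using j by (simp add: sum.remove)
      then have "s (x j) (g j) = - (\<Sum>l\<in>{..<r} - {j}. s (x l) (g l))"
        using rel by (simp add: eq_neg_iff_add_eq_0)
      then have "s c (s (x j) (g j)) = s c (- (\<Sum>l\<in>{..<r} - {j}. s (x l) (g l)))" by simp
      then have "g j = s c (- (\<Sum>l\<in>{..<r} - {j}. s (x l) (g l)))" by (simp only: scale_scale c scale_one)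
      also have "\<dots> \<in> span (S - {g j})"
      proof (intro span_scale span_neg span_sum span_scale span_base)
        fix l assume "l \<in> {..<r} - {j}"
        then show "g l \<in> S - {g j}"
          using g j gS by (auto simp: bij_betw_def inj_on_def)
      qed
      finally have "g j \<in> span (S - {g j})" .
      then have "S \<subseteq> span (S - {g j})" using span_superset[of "S - {g j}"] by blast
      then have "span (S - {g j}) = span S"
        using span_superset[of S] by (auto simp: span_eq)
      then have "Gen (S - {g j})" using S(1) by (auto simp: Gen_def)
      then have "card S \<le> card (S - {g j})" by (rule S(2))
      moreover have "card (S - {g j}) < card S"
        using gj S(1) by (intro card_Diff1_less) (auto simp: Gen_def)
      ultimately show False by simp
    qed
  qed
qed

subsection \<open>Local rings\<close>

lemma maximal_ideal_exists:
  assumes J: "ideal J" "1 \<notin> J"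
  obtains I where "maximal_ideal I" "J \<subseteq> I"
proof -
  define C where "C = {I. ideal I \<and> J \<subseteq> I \<and> 1 \<notin> I}"
  have "\<exists>M\<in>C. \<forall>X\<in>C. M \<subseteq> X \<longrightarrow> X = M"
  proof (rule subset_Zorn_nonempty)
    show "C \<noteq> {}" using J by (auto simp: C_def)
    fix \<C> assume ne: "\<C> \<noteq> {}" and ch: "subset.chain C \<C>"
    then obtain I0 where I0: "I0 \<in> \<C>" by blast
    have C: "\<And>I. I \<in> \<C> \<Longrightarrow> ideal I \<and> J \<subseteq> I \<and> 1 \<notin> I"
      using ch by (auto simp: subset_chain_def C_def)
    have "ideal (\<Union>\<C>)"
    proof (rule ring.subspaceI)
      show "0 \<in> \<Union>\<C>" using I0 C ring.subspace_0 by blast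
      show "x + y \<in> \<Union>\<C>" if x: "x \<in> \<Union>\<C>" and y: "y \<in> \<Union>\<C>" for x y
      proof -
        obtain I1 I2 where I: "I1 \<in> \<C>" "x \<in> I1" "I2 \<in> \<C>" "y \<in> I2" using x y by blast
        then have "I1 \<subseteq> I2 \<or> I2 \<subseteq> I1" using ch by (auto simp: subset_chain_def)
        then show ?thesis using I C ring.subspace_add by blast
      qed
      show "c * x \<in> \<Union>\<C>" if "x \<in> \<Union>\<C>" for c x
        using that C ring.subspace_scale by blast
    qed
    then show "\<Union>\<C> \<in> C" using C I0 by (auto simp: C_def)
  qed
  then obtain I where I: "I \<in> C" "\<And>X. X \<in> C \<Longrightarrow> I \<subseteq> X \<Longrightarrow> X = I" by blast
  have "X = I \<or> X = UNIV" if X: "ideal X" "I \<subseteq> X" for X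
  proof (cases "1 \<in> X")
    case True
    then have "x \<in> X" for x using ring.subspace_scale[OF X(1) True, of x] by simp
    then show ?thesis by blast
  next
    case False
    then show ?thesis using I X by (auto simp: C_def)
  qed
  then have "maximal_ideal I" using I(1) by (auto simp: maximal_ideal_def C_def)
  then show thesis using that I(1) by (auto simp: C_def)
qed

lemma local_ring_unit:
  assumes "noetherian_local_ring m" "a \<notin> m"
  obtains c where "c * a = 1"
proof (rule ccontr)
  assume *: "\<not> thesis"
  have "ideal (range (\<lambda>c. c * a))"
    by (metis ring.span_singleton ring.subspace_span)
  moreover have "1 \<notin> range (\<lambda>c. c * a)" using * that by (metis imageE)
  ultimately obtain I where I: "maximal_ideal I" "range (\<lambda>c. c * a) \<subseteq> I"
    by (rule maximal_ideal_exists)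
  have "1 * a \<in> I" using I(2) by blast
  moreover have "I = m" using I(1) assms(1) unfolding noetherian_local_ring_def by blast
  ultimately show False using assms(2) by simp
qed

text \<open>A relation with a coefficient outside \<open>m\<close> would have a unit coefficient.\<close>

lemma local_minimal_cover:
  assumes "noetherian_local_ring m" "module s" "finite T" "module.span s T = K"
  obtains r f where "module_hom vscale s f" "f ` free_mod r = K" "{x \<in> free_mod r. f x = 0} \<subseteq> ideal_free m r"
proof -
  interpret module s by fact
  obtain r :: nat and g where g: "g ` {..<r} \<subseteq> UNIV" "span (g ` {..<r}) = K"
      "\<And>x j c. (\<Sum>l<r. s (x l) (g l)) = 0 \<Longrightarrow> j < r \<Longrightarrow> c * x j \<noteq> 1"
    by (rule irredundant_generators[OF assms(2,3) subset_UNIV assms(4)]) blast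
  have "maximal_ideal m" using assms(1) unfolding noetherian_local_ring_def by blast
  then have m0: "0 \<in> m" unfolding maximal_ideal_def using ring.subspace_0 by blast
  show thesis
  proof
    show "module_hom vscale s (lin_comb s r g)" by (rule module_hom_lin_comb[OF assms(2)])
    show "lin_comb s r g ` free_mod r = K" by (simp add: lin_comb_image[OF assms(2)] g(2))
    show "{x \<in> free_mod r. lin_comb s r g x = 0} \<subseteq> ideal_free m r"
    proof safe
      fix x assume x: "x \<in> free_mod r" "lin_comb s r g x = 0"
      have "x j \<in> m" for j
      proof (cases "j < r")
        case True
        then show ?thesis
          using local_ring_unit[OF assms(1)] g(3)[OF x(2)[unfolded lin_comb_def] True] by metis
      qed (use x(1) m0 in \<open>auto simp: free_mod_def\<close>)
      then show "x \<in> ideal_free m r" using x(1) by (simp add: ideal_free_def)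
    qed
  qed
qed

lemma local_minimal_resolution:
  fixes m :: "'r::comm_ring_1 set"
  assumes loc: "noetherian_local_ring m" and "module s" "finitely_generated s"
  obtains b d e where "minimal_free_resolution m s b d e"
proof -
  have noeth: "noetherian TYPE('r)" and "maximal_ideal m"
    using loc unfolding noetherian_local_ring_def by blast+
  then have ideal: "ideal m" unfolding maximal_ideal_def by blast
  obtain T where T: "finite T" "module.span s T = UNIV"
    using assms(3) by (auto simp: finitely_generated_def)
  obtain r e where e: "module_hom vscale s e" "e ` free_mod r = UNIV"
      "{x \<in> free_mod r. e x = 0} \<subseteq> ideal_free m r"
    by (rule local_minimal_cover[OF loc assms(2) T])
  have ker: "vec.subspace {x \<in> free_mod n. f x = 0}" if "module_hom vscale t f"
    for n :: nat and t :: "'r \<Rightarrow> 'x::ab_group_add \<Rightarrow> 'x" and f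
    using vec.subspace_inter[OF subspace_free_mod module_hom.subspace_kernel[OF that]]
    by (simp add: Collect_conj_eq)
  show thesis
  proof (rule minimal_resolution_exists[where ?t0.0 = "()" and linked = "\<lambda>_ _ _ _ _. True"
        and good = "\<lambda>b _ K. vec.subspace K \<and> K \<subseteq> ideal_free m b", OF ideal e(1,2)])
    show "vec.subspace {x \<in> free_mod r. e x = 0} \<and> {x \<in> free_mod r. e x = 0} \<subseteq> ideal_free m r"
      using ker[OF e(1)] e(3) by blast
    fix b :: nat and t :: unit and K :: "(nat \<Rightarrow> 'r) set"
    assume K: "vec.subspace K \<and> K \<subseteq> ideal_free m b"
    then show "K \<subseteq> ideal_free m b" by blast
    have "K \<subseteq> free_mod b" using K by (auto simp: ideal_free_def)
    with K obtain S where S: "finite S" "vec.span S = K"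
      using noetherian_free_mod[OF noeth, of K b] by blast
    obtain r' f where f: "module_hom vscale vscale f" "f ` free_mod r' = K"
        "{x \<in> free_mod r'. f x = 0} \<subseteq> ideal_free m r'"
      by (rule local_minimal_cover[OF loc vec.module_axioms S])
    then show "\<exists>b' t' d. module_hom vscale vscale d \<and> d ` free_mod b' = K \<and>
        (vec.subspace {x \<in> free_mod b'. d x = 0} \<and> {x \<in> free_mod b'. d x = 0} \<subseteq> ideal_free m b') \<and> True"
      using ker[OF f(1)] by blast
  qed (use that in blast)
qed

subsection \<open>Hilbert's basis theorem\<close>

definition subring :: "'r::comm_ring_1 set \<Rightarrow> bool" where
  "subring B \<longleftrightarrow> 1 \<in> B \<and> (\<forall>x\<in>B. \<forall>y\<in>B. x - y \<in> B \<and> x * y \<in> B)"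

lemma subringD:
  assumes "subring B"
  shows "0 \<in> B" "1 \<in> B" "x \<in> B \<Longrightarrow> - x \<in> B" "x \<in> B \<Longrightarrow> y \<in> B \<Longrightarrow> x + y \<in> B"
    "x \<in> B \<Longrightarrow> y \<in> B \<Longrightarrow> x - y \<in> B" "x \<in> B \<Longrightarrow> y \<in> B \<Longrightarrow> x * y \<in> B"
proof -
  have d: "\<And>x y. x \<in> B \<Longrightarrow> y \<in> B \<Longrightarrow> x - y \<in> B" using assms by (auto simp: subring_def)
  show "1 \<in> B" "x \<in> B \<Longrightarrow> y \<in> B \<Longrightarrow> x * y \<in> B" using assms by (auto simp: subring_def)
  show z: "0 \<in> B" using d[of 1 1] assms by (simp add: subring_def)
  show n: "x \<in> B \<Longrightarrow> - x \<in> B" for x using d[OF z, of x] by simp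
  show "x \<in> B \<Longrightarrow> y \<in> B \<Longrightarrow> x + y \<in> B" using d[of x "- y"] n by simp
  show "x \<in> B \<Longrightarrow> y \<in> B \<Longrightarrow> x - y \<in> B" by (rule d)
qed

text \<open>A subring is a set and not a type, so spans over it are not spans in a module over a type.\<close>

inductive_set sub_span :: "'r::comm_ring_1 set \<Rightarrow> 'r set \<Rightarrow> 'r set" for B S where
  zero: "0 \<in> sub_span B S"
| add: "u \<in> sub_span B S \<Longrightarrow> y \<in> S \<Longrightarrow> c \<in> B \<Longrightarrow> u + c * y \<in> sub_span B S"

lemma sub_span_base: "subring B \<Longrightarrow> y \<in> S \<Longrightarrow> y \<in> sub_span B S"
  using sub_span.add[OF sub_span.zero, of y S 1 B] by (simp add: subringD)

lemma sub_span_plus: "v \<in> sub_span B S \<Longrightarrow> u \<in> sub_span B S \<Longrightarrow> u + v \<in> sub_span B S"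
  by (induction rule: sub_span.induct) (auto simp: add.assoc[symmetric] intro: sub_span.intros)

lemma sub_span_mult:
  assumes "subring B" "c \<in> B"
  shows "u \<in> sub_span B S \<Longrightarrow> c * u \<in> sub_span B S"
  by (induction rule: sub_span.induct)
     (auto simp: distrib_left mult.assoc[symmetric] intro!: sub_span.intros subringD(6)[OF assms(1)] assms)

lemma sub_span_least:
  assumes "\<And>x y. x \<in> J \<Longrightarrow> y \<in> J \<Longrightarrow> x + y \<in> J" "\<And>c x. c \<in> B \<Longrightarrow> x \<in> J \<Longrightarrow> c * x \<in> J" "0 \<in> J" "S \<subseteq> J"
  shows "sub_span B S \<subseteq> J"
proof
  show "u \<in> J" if "u \<in> sub_span B S" for u
    using that by induction (use assms in blast)+
qed

lemma sub_span_trans: "subring B \<Longrightarrow> S \<subseteq> sub_span B T \<Longrightarrow> sub_span B S \<subseteq> sub_span B T"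
  by (rule sub_span_least) (auto intro: sub_span_plus sub_span_mult sub_span.zero)

lemma sub_span_mono: "S \<subseteq> T \<Longrightarrow> u \<in> sub_span B S \<Longrightarrow> u \<in> sub_span B T"
  by (erule sub_span.induct) (auto intro: sub_span.intros)

definition ideal_in :: "'r::comm_ring_1 set \<Rightarrow> 'r set \<Rightarrow> bool" where
  "ideal_in B J \<longleftrightarrow> J \<subseteq> B \<and> 0 \<in> J \<and> (\<forall>x\<in>J. \<forall>y\<in>J. x + y \<in> J) \<and> (\<forall>c\<in>B. \<forall>x\<in>J. c * x \<in> J)"

definition noetherian_subring :: "'r::comm_ring_1 set \<Rightarrow> bool" where
  "noetherian_subring B \<longleftrightarrow> subring B \<and> (\<forall>J. ideal_in B J \<longrightarrow> (\<exists>S. finite S \<and> S \<subseteq> J \<and> J \<subseteq> sub_span B S))"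

lemma ideal_in_sub_span: "subring B \<Longrightarrow> S \<subseteq> B \<Longrightarrow> ideal_in B (sub_span B S)"
  unfolding ideal_in_def using sub_span_least[of B B S] subringD[of B]
  by (auto intro: sub_span_plus sub_span_mult sub_span.zero)

text \<open>The ascending chain condition for the ideals generated by the initial segments of a sequence.\<close>

lemma noetherian_subring_sequence:
  assumes B: "noetherian_subring B" and a: "\<And>n::nat. a n \<in> B"
  obtains n where "a n \<in> sub_span B (a ` {..<n})"
proof -
  have sr: "subring B" using B by (simp add: noetherian_subring_def)
  have "ideal_in B (sub_span B (range a))" using a by (intro ideal_in_sub_span sr) blast
  then obtain S where S: "finite S" "S \<subseteq> sub_span B (range a)" "sub_span B (range a) \<subseteq> sub_span B S"
    using B unfolding noetherian_subring_def by blast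
  have finitary: "\<exists>n. u \<in> sub_span B (a ` {..<n})" if "u \<in> sub_span B (range a)" for u
    using that
  proof induction
    case zero
    then show ?case by (blast intro: sub_span.zero)
  next
    case (add u y c)
    then obtain n k where "u \<in> sub_span B (a ` {..<n})" "y = a k" by blast
    then have "u \<in> sub_span B (a ` {..<max n (Suc k)})" "y \<in> a ` {..<max n (Suc k)}"
      by (auto intro: sub_span_mono[rotated])
    then show ?case using add.hyps(3) by (blast intro: sub_span.add)
  qed
  have "\<exists>n. S \<subseteq> sub_span B (a ` {..<n})"
    using S(1,2)
  proof (induction S)
    case (insert x S)
    then obtain n k where "S \<subseteq> sub_span B (a ` {..<n})" "x \<in> sub_span B (a ` {..<k})"
      using finitary by blast
    then have "insert x S \<subseteq> sub_span B (a ` {..<max n k})"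
      using sub_span_mono[of "a ` {..<n}" "a ` {..<max n k}"] sub_span_mono[of "a ` {..<k}" "a ` {..<max n k}"]
      by (auto simp: image_mono)
    then show ?case by blast
  qed simp
  then obtain n where "S \<subseteq> sub_span B (a ` {..<n})" ..
  then have "sub_span B (range a) \<subseteq> sub_span B (a ` {..<n})"
    using S(3) sub_span_trans[OF sr] by blast
  then show thesis using sub_span_base[OF sr, of "a n" "range a"] that by blast
qed

definition poly_over :: "'r::comm_ring_1 set \<Rightarrow> 'r poly \<Rightarrow> bool" where
  "poly_over B p \<longleftrightarrow> (\<forall>i. coeff p i \<in> B)"

definition adjoin :: "'r::comm_ring_1 set \<Rightarrow> 'r \<Rightarrow> 'r set" where
  "adjoin B x = {poly p x | p. poly_over B p}"

lemma poly_over_closed: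
  assumes "subring B"
  shows "poly_over B 0" "poly_over B p \<Longrightarrow> poly_over B q \<Longrightarrow> poly_over B (p + q)"
    "poly_over B p \<Longrightarrow> poly_over B q \<Longrightarrow> poly_over B (p - q)"
    "poly_over B p \<Longrightarrow> poly_over B q \<Longrightarrow> poly_over B (p * q)" "c \<in> B \<Longrightarrow> poly_over B (monom c n)"
proof -
  note sr = subringD[OF assms]
  have "sum f S \<in> B" if "\<And>i. i \<in> S \<Longrightarrow> f i \<in> B" for f and S :: "nat set"
    using that by (induction S rule: infinite_finite_induct) (auto intro: sr)
  then show "poly_over B p \<Longrightarrow> poly_over B q \<Longrightarrow> poly_over B (p * q)"
    using sr(6) by (simp add: poly_over_def coeff_mult)
qed (use subringD[OF assms] in \<open>auto simp: poly_over_def\<close>)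

lemma subring_adjoin:
  assumes "subring B" shows "subring (adjoin B x)"
  unfolding subring_def
proof (intro conjI ballI)
  show "1 \<in> adjoin B x"
    unfolding adjoin_def using poly_over_closed(5)[OF assms subringD(2)[OF assms], of 0]
    by (auto intro!: exI[of _ "monom 1 0"] simp: poly_monom)
  fix u v assume "u \<in> adjoin B x" "v \<in> adjoin B x"
  then obtain p q where pq: "u = poly p x" "poly_over B p" "v = poly q x" "poly_over B q"
    by (auto simp: adjoin_def)
  show "u - v \<in> adjoin B x" "u * v \<in> adjoin B x"
    unfolding adjoin_def pq(1,3)
    using poly_over_closed(3,4)[OF assms pq(2,4)] by (metis (mono_tags, lifting) mem_Collect_eq poly_diff, metis (mono_tags, lifting) mem_Collect_eq poly_mult)
qed

lemma adjoin_superset: "subring B \<Longrightarrow> B \<subseteq> adjoin B x" "subring B \<Longrightarrow> x \<in> adjoin B x"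
proof -
  assume sr: "subring B"
  show "B \<subseteq> adjoin B x"
  proof
    fix c assume "c \<in> B"
    then have "poly_over B (monom c 0)" "poly (monom c 0) x = c"
      using poly_over_closed(5)[OF sr] by (auto simp: poly_monom)
    then show "c \<in> adjoin B x" unfolding adjoin_def by (metis (mono_tags, lifting) mem_Collect_eq)
  qed
  have "poly_over B (monom 1 1)" "poly (monom 1 1) x = x"
    using poly_over_closed(5)[OF sr subringD(2)[OF sr]] by (auto simp: poly_monom)
  then show "x \<in> adjoin B x" unfolding adjoin_def by (metis (mono_tags, lifting) mem_Collect_eq)
qed

text \<open>Hilbert's argument: if an ideal were not finitely generated, successively choosing polynomials of least degree
  outside the ideal generated so far would give leading coefficients none of which is a combination of the
  earlier ones.\<close>

lemma noetherian_adjoin: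
  assumes B: "noetherian_subring B"
  shows "noetherian_subring (adjoin B x)"
proof -
  have sr: "subring B" using B by (simp add: noetherian_subring_def)
  note C = subring_adjoin[OF sr, of x]
  have "\<exists>S. finite S \<and> S \<subseteq> J \<and> J \<subseteq> sub_span (adjoin B x) S" if J: "ideal_in (adjoin B x) J" for J
  proof (rule ccontr)
    assume inf: "\<not> ?thesis"
    define sp where "sp p n = sub_span (adjoin B x) ((\<lambda>i. poly (p i) x) ` {..<n})" for p :: "nat \<Rightarrow> 'a poly" and n
    define cand where "cand p n q \<longleftrightarrow> poly_over B q \<and> poly q x \<in> J \<and> poly q x \<notin> sp p n" for p n q
    define Sel where "Sel p n q \<longleftrightarrow> ((\<forall>i<n. poly (p i) x \<in> J) \<longrightarrow>
        cand p n q \<and> (\<forall>q'. cand p n q' \<longrightarrow> degree q \<le> degree q'))" for p n q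
    have "\<exists>p. \<forall>n. Sel p n (p n)"
    proof (rule dependent_wellorder_choice)
      fix q and n :: nat and p p' :: "nat \<Rightarrow> 'a poly"
      assume eq: "\<And>i. i < n \<Longrightarrow> p i = p' i"
      then have "sp p n = sp p' n" by (simp add: sp_def cong: image_cong_simp)
      then show "Sel p n q = Sel p' n q" using eq by (simp add: Sel_def cand_def)
    next
      fix n :: nat and p :: "nat \<Rightarrow> 'a poly"
      show "\<exists>q. Sel p n q"
      proof (cases "\<forall>i<n. poly (p i) x \<in> J")
        case True
        then have "\<not> J \<subseteq> sp p n"
          using inf unfolding sp_def by (metis (no_types, lifting) finite_imageI finite_lessThan image_subset_iff lessThan_iff)
        then obtain u where "u \<in> J" "u \<notin> sp p n" by blast
        moreover have "u \<in> adjoin B x" using J \<open>u \<in> J\<close> by (auto simp: ideal_in_def)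
        ultimately obtain q0 where "cand p n q0" by (auto simp: adjoin_def cand_def)
        then show ?thesis using ex_has_least_nat[of "cand p n" q0 degree] by (auto simp: Sel_def)
      qed (auto simp: Sel_def)
    qed
    then obtain p where p: "\<And>n. Sel p n (p n)" by blast
    have pJ: "poly (p n) x \<in> J" for n
      by (induction n rule: less_induct) (use p in \<open>auto simp: Sel_def cand_def\<close>)
    have cand: "cand p n (p n)" and least: "\<And>q. cand p n q \<Longrightarrow> degree (p n) \<le> degree q" for n
      using p[of n] pJ by (auto simp: Sel_def)
    have sp_mono: "u \<in> sp p n" if "u \<in> sp p i" "i \<le> n" for u i n
      using that(1) unfolding sp_def by (rule sub_span_mono[rotated]) (use that(2) in auto)
    have deg: "degree (p i) \<le> degree (p n)" if "i \<le> n" for i n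
      using cand[of n] sp_mono[OF _ that] by (intro least) (auto simp: cand_def)
    have over: "poly_over B (p n)" for n using cand by (simp add: cand_def)
    obtain n where n: "lead_coeff (p n) \<in> sub_span B ((\<lambda>i. lead_coeff (p i)) ` {..<n})"
      using noetherian_subring_sequence[OF B, of "\<lambda>i. lead_coeff (p i)"] over by (auto simp: poly_over_def)
    have sp_poly: "poly q x * poly (p i) x \<in> sp p n" if "poly_over B q" "i < n" for q i
      unfolding sp_def
      by (intro sub_span_mult[OF C] sub_span_base[OF C]) (use that in \<open>auto simp: adjoin_def\<close>)
    have "\<exists>q. poly_over B q \<and> degree q \<le> degree (p n) \<and> coeff q (degree (p n)) = c \<and> poly q x \<in> sp p n"
      if "c \<in> sub_span B ((\<lambda>i. lead_coeff (p i)) ` {..<n})" for c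
      using that
    proof induction
      case zero
      show ?case by (rule exI[of _ 0]) (auto simp: poly_over_closed[OF sr] sp_def sub_span.zero)
    next
      case (add u y c)
      then obtain q i where q: "poly_over B q" "degree q \<le> degree (p n)" "coeff q (degree (p n)) = u"
          "poly q x \<in> sp p n" and i: "i < n" "y = lead_coeff (p i)" by blast
      define k where "k = degree (p n) - degree (p i)"
      have k: "degree (p n) = k + degree (p i)" using deg[of i n] i(1) by (simp add: k_def)
      let ?q = "q + monom c k * p i"
      have "poly_over B ?q"
        by (intro poly_over_closed[OF sr] q(1) over add.hyps)
      moreover have "degree (monom c k * p i) \<le> degree (p n)"
        using degree_mult_le[of "monom c k" "p i"] degree_monom_le[of c k] by (simp add: k)
      then have "degree ?q \<le> degree (p n)" using q(2) by (intro degree_add_le)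
      moreover have "coeff ?q (degree (p n)) = u + c * y"
        using q(3) by (simp add: i(2) k coeff_monom_mult)
      moreover have "poly ?q x \<in> sp p n"
        using sub_span_plus[OF sp_poly[OF poly_over_closed(5)[OF sr add.hyps(3)] i(1), unfolded sp_def] q(4)[unfolded sp_def]]
        by (simp add: sp_def)
      ultimately show ?case by blast
    qed
    then obtain q where q: "poly_over B q" "degree q \<le> degree (p n)" "coeff q (degree (p n)) = lead_coeff (p n)"
        "poly q x \<in> sp p n" using n by blast
    let ?r = "p n - q"
    have "poly ?r x \<notin> sp p n"
    proof
      assume "poly ?r x \<in> sp p n"
      then have "poly ?r x + poly q x \<in> sp p n" using q(4) unfolding sp_def by (intro sub_span_plus)
      then show False using cand[of n] by (simp add: cand_def)
    qed
    moreover have "poly ?r x \<in> J"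
    proof -
      have "sp p n \<subseteq> J"
        using J pJ unfolding sp_def ideal_in_def by (intro sub_span_least) auto
      then have "poly q x \<in> J" using q(4) by blast
      moreover have "- 1 \<in> adjoin B x" using subringD[OF C] by blast
      ultimately have "- 1 * poly q x \<in> J" using J by (auto simp: ideal_in_def)
      then have "poly (p n) x + - 1 * poly q x \<in> J" using J pJ unfolding ideal_in_def by blast
      then show ?thesis by simp
    qed
    moreover have "poly_over B ?r" by (intro poly_over_closed[OF sr] over q(1))
    ultimately have cr: "cand p n ?r" by (simp add: cand_def)
    have "degree ?r \<le> degree (p n)" using q(2) by (intro degree_diff_le) auto
    then have "degree ?r = degree (p n)" using least[OF cr] by simp
    then have "lead_coeff ?r = 0" using q(3) by simp
    then have "?r = 0" by (simp only: leading_coeff_0_iff)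
    then show False using cr by (simp add: cand_def sp_def sub_span.zero)
  qed
  then show ?thesis using C by (simp add: noetherian_subring_def)
qed

lemma noetherian_subring_generated:
  assumes "noetherian_subring B" "finite X"
  obtains C where "noetherian_subring C" "B \<union> X \<subseteq> C"
  using assms(2)
proof (induction X arbitrary: thesis)
  case empty
  then show ?case using assms(1) by blast
next
  case (insert x X)
  then obtain C where C: "noetherian_subring C" "B \<union> X \<subseteq> C" by blast
  then have "subring C" by (simp add: noetherian_subring_def)
  then show ?case
    using insert.prems[OF noetherian_adjoin[OF C(1), of x]] C(2) adjoin_superset[of C x] by blast
qed

lemma noetherian_subring_UNIV:
  assumes "noetherian_subring (UNIV :: 'r::comm_ring_1 set)"
  shows "noetherian TYPE('r)"
  unfolding noetherian_def
proof (intro allI impI)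
  fix I :: "'r set" assume I: "ideal I"
  then have "ideal_in UNIV I" by (auto simp: ideal_in_def ring.subspace_def)
  then obtain S where S: "finite S" "S \<subseteq> I" "I \<subseteq> sub_span UNIV S"
    using assms unfolding noetherian_subring_def by blast
  have "sub_span UNIV S \<subseteq> ring.span S"
    by (rule sub_span_least) (auto intro: ring.span_add ring.span_scale ring.span_zero ring.span_base)
  then show "\<exists>S. finite S \<and> I = ring.span S"
    using S ring.span_minimal[OF S(2) I] by blast
qed

subsection \<open>Homogeneous components\<close>

definition component :: "(int \<Rightarrow> 'm::ab_group_add set) \<Rightarrow> 'm \<Rightarrow> int \<Rightarrow> 'm" where
  "component G x = (THE f. (\<forall>n. f n \<in> G n) \<and> finite {n. f n \<noteq> 0} \<and> x = (\<Sum>n | f n \<noteq> 0. f n))"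

locale graded_group =
  fixes G :: "int \<Rightarrow> 'm::ab_group_add set"
  assumes grading: "grading G"
begin

lemma G_zero: "0 \<in> G n" and G_diff: "x \<in> G n \<Longrightarrow> y \<in> G n \<Longrightarrow> x - y \<in> G n"
  using grading by (auto simp: grading_def)

lemma G_neg: "x \<in> G n \<Longrightarrow> - x \<in> G n"
  using G_diff[OF G_zero] by fastforce

lemma G_add: "x \<in> G n \<Longrightarrow> y \<in> G n \<Longrightarrow> x + y \<in> G n"
  using G_diff[of x n "- y"] G_neg by simp

lemma component_props:
  "(\<forall>n. component G x n \<in> G n) \<and> finite {n. component G x n \<noteq> 0}
    \<and> x = (\<Sum>n | component G x n \<noteq> 0. component G x n)"
proof -
  have "\<exists>!f. (\<forall>n. f n \<in> G n) \<and> finite {n. f n \<noteq> 0} \<and> x = (\<Sum>n | f n \<noteq> 0. f n)"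
    using grading by (simp add: grading_def)
  from theI'[OF this] show ?thesis unfolding component_def .
qed

lemma component_in: "component G x n \<in> G n"
  and component_finite: "finite {n. component G x n \<noteq> 0}"
  and component_sum: "(\<Sum>n | component G x n \<noteq> 0. component G x n) = x"
  using component_props[of x] by auto

lemma component_unique:
  assumes "\<And>n. f n \<in> G n" "finite S" "\<And>n. n \<notin> S \<Longrightarrow> f n = 0" "x = (\<Sum>n\<in>S. f n)"
  shows "component G x = f"
proof -
  have sub: "{n. f n \<noteq> 0} \<subseteq> S" using assms(3) by blast
  have "x = (\<Sum>n | f n \<noteq> 0. f n)"
    unfolding assms(4) by (rule sum.mono_neutral_right[OF assms(2) sub]) auto
  then have "(\<forall>n. f n \<in> G n) \<and> finite {n. f n \<noteq> 0} \<and> x = (\<Sum>n | f n \<noteq> 0. f n)"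
    using assms(1) finite_subset[OF sub assms(2)] by blast
  moreover have "\<exists>!f. (\<forall>n. f n \<in> G n) \<and> finite {n. f n \<noteq> 0} \<and> x = (\<Sum>n | f n \<noteq> 0. f n)"
    using grading by (simp add: grading_def)
  ultimately show ?thesis using component_props[of x] by blast
qed

lemma component_sum_superset:
  assumes "finite S" "{n. component G x n \<noteq> 0} \<subseteq> S"
  shows "(\<Sum>n\<in>S. component G x n) = x"
  using sum.mono_neutral_right[OF assms, of "component G x"] component_sum[of x] by simp

lemma component_homogeneous:
  assumes "x \<in> G k" shows "component G x n = (if n = k then x else 0)"
  using component_unique[of "\<lambda>n. if n = k then x else 0" "{k}" x] assms G_zero by auto

lemma component_zero [simp]: "component G 0 n = 0"
  using component_homogeneous[OF G_zero, of n n] by simp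

lemma component_add: "component G (x + y) n = component G x n + component G y n"
proof -
  let ?S = "{n. component G x n \<noteq> 0} \<union> {n. component G y n \<noteq> 0}"
  have fin: "finite ?S" using component_finite by blast
  have "component G (x + y) = (\<lambda>n. component G x n + component G y n)"
  proof (rule component_unique[OF _ fin])
    show "x + y = (\<Sum>n\<in>?S. component G x n + component G y n)"
      using component_sum_superset[OF fin, of x] component_sum_superset[OF fin, of y]
      by (simp add: sum.distrib)
  qed (auto intro: G_add component_in)
  then show ?thesis by simp
qed

end

locale graded_algebra =
  fixes A :: "int \<Rightarrow> 'r::comm_ring_1 set"
  assumes standard: "standard_graded_algebra A"
begin

sublocale A: graded_group A
  using standard by unfold_locales (simp add: standard_graded_algebra_def)

lemma A_mult: "a \<in> A i \<Longrightarrow> c \<in> A j \<Longrightarrow> a * c \<in> A (i + j)"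
  and A_negative: "i < 0 \<Longrightarrow> A i = {0}"
  and A_one: "1 \<in> A 0"
  and A_unit: "a \<in> A 0 \<Longrightarrow> a \<noteq> 0 \<Longrightarrow> \<exists>c\<in>A 0. a * c = 1"
  and A_generated: "\<exists>X. finite X \<and> X \<subseteq> A 1 \<and>
        (\<lambda>S. \<forall>x\<in>S. \<forall>y\<in>S. x + y \<in> S \<and> x * y \<in> S) hull (A 0 \<union> X) = UNIV"
  using standard by (simp_all add: standard_graded_algebra_def)

text \<open>The field \<open>A 0\<close> has only trivial ideals, and the ring arises from it by adjoining finitely many elements.\<close>

lemma graded_algebra_noetherian: "noetherian TYPE('r)"
proof -
  have sr: "subring (A 0)"
    using A_one A_mult[of _ 0 _ 0] A.G_diff by (auto simp: subring_def)
  have "noetherian_subring (A 0)"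
    unfolding noetherian_subring_def
  proof (intro conjI sr allI impI)
    fix J assume J: "ideal_in (A 0) J"
    show "\<exists>S. finite S \<and> S \<subseteq> J \<and> J \<subseteq> sub_span (A 0) S"
    proof (cases "J = {0}")
      case True
      then show ?thesis by (intro exI[of _ "{}"]) (auto intro: sub_span.zero)
    next
      case False
      then obtain a where a: "a \<in> J" "a \<in> A 0" "a \<noteq> 0" using J by (auto simp: ideal_in_def)
      then obtain c where c: "c \<in> A 0" "a * c = 1" using A_unit by blast
      have "u \<in> sub_span (A 0) {a}" if "u \<in> J" for u
      proof -
        have "u \<in> A 0" using that J by (auto simp: ideal_in_def)
        then have "(u * c) * a \<in> sub_span (A 0) {a}"
          by (intro sub_span_mult[OF sr] sub_span_base[OF sr] subringD(6)[OF sr] c) auto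
        moreover have "(u * c) * a = u" using c(2) by (simp add: mult.assoc mult.commute[of c a])
        ultimately show ?thesis by simp
      qed
      then show ?thesis using a(1) by (intro exI[of _ "{a}"]) auto
    qed
  qed
  moreover obtain X where X: "finite X"
      "(\<lambda>S. \<forall>x\<in>S. \<forall>y\<in>S. x + y \<in> S \<and> x * y \<in> S) hull (A 0 \<union> X) = UNIV"
    using A_generated by blast
  ultimately obtain C where C: "noetherian_subring C" "A 0 \<union> X \<subseteq> C"
    using noetherian_subring_generated by blast
  then have "subring C" by (simp add: noetherian_subring_def)
  then have "(\<lambda>S. \<forall>x\<in>S. \<forall>y\<in>S. x + y \<in> S \<and> x * y \<in> S) hull (A 0 \<union> X) \<subseteq> C"
    using C(2) by (intro hull_minimal) (auto intro: subringD)
  then have "C = UNIV" using X(2) by blast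
  then show ?thesis using noetherian_subring_UNIV C(1) by blast
qed

abbreviation M :: "'r set" where "M \<equiv> irrelevant_ideal A"

lemma irrelevant_ideal_ideal: "ideal M"
  by (simp add: irrelevant_ideal_def)

lemma irrelevant_idealI: "component A a 0 = 0 \<Longrightarrow> a \<in> M"
proof -
  assume a: "component A a 0 = 0"
  have "component A a n \<in> M" if "component A a n \<noteq> 0" for n
  proof -
    have "n > 0"
      using that a A_negative[of n] A.component_in[of a n] by (cases "n = 0"; cases "n < 0") auto
    then show ?thesis
      unfolding irrelevant_ideal_def using A.component_in by (intro ring.span_base) blast
  qed
  then have "(\<Sum>n | component A a n \<noteq> 0. component A a n) \<in> M"
    by (intro ring.subspace_sum[OF irrelevant_ideal_ideal]) blast
  then show "a \<in> M" by (simp add: A.component_sum)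
qed

text \<open>The twisted components of a vector; \<open>t j\<close> is the degree of the \<open>j\<close>-th basis vector.\<close>

definition free_component :: "(nat \<Rightarrow> int) \<Rightarrow> (nat \<Rightarrow> 'r) \<Rightarrow> int \<Rightarrow> nat \<Rightarrow> 'r" where
  "free_component t x n = (\<lambda>j. component A (x j) (n - t j))"

lemma component_mult:
  assumes "c \<in> A k"
  shows "component A (a * c) n = component A a (n - k) * c"
proof -
  have "component A (a * c) = (\<lambda>n. component A a (n - k) * c)"
  proof (rule A.component_unique[of _ "(+) k ` {n. component A a n \<noteq> 0}"])
    show "component A a (n - k) * c \<in> A n" for n
      using A_mult[OF A.component_in[of a "n - k"] assms] by simp
    show "component A a (n - k) * c = 0" if "n \<notin> (+) k ` {n. component A a n \<noteq> 0}" for n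
    proof -
      have "component A a (n - k) = 0" using that by (force simp: image_iff)
      then show ?thesis by simp
    qed
    have "(\<Sum>n\<in>(+) k ` {n. component A a n \<noteq> 0}. component A a (n - k) * c)
        = (\<Sum>n | component A a n \<noteq> 0. component A a n * c)"
      by (subst sum.reindex) (auto simp: inj_on_def)
    then show "a * c = (\<Sum>n\<in>(+) k ` {n. component A a n \<noteq> 0}. component A a (n - k) * c)"
      by (simp add: sum_distrib_right[symmetric] A.component_sum)
  qed (use A.component_finite in blast)
  then show ?thesis by simp
qed

lemma component_smult:
  assumes "graded_module A s G" "y \<in> G k"
  shows "component G (s a y) n = s (component A a (n - k)) y"
proof -
  interpret module s using assms(1) by (simp add: graded_module_def)
  interpret G: graded_group G using assms(1) by unfold_locales (simp add: graded_module_def)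
  have smult: "\<And>i a. a \<in> A i \<Longrightarrow> s a y \<in> G (i + k)"
    using assms by (auto simp: graded_module_def)
  have "component G (s a y) = (\<lambda>n. s (component A a (n - k)) y)"
  proof (rule G.component_unique[of _ "(+) k ` {n. component A a n \<noteq> 0}"])
    show "s (component A a (n - k)) y \<in> G n" for n
      using smult[OF A.component_in[of a "n - k"]] by simp
    show "s (component A a (n - k)) y = 0" if "n \<notin> (+) k ` {n. component A a n \<noteq> 0}" for n
    proof -
      have "component A a (n - k) = 0" using that by (force simp: image_iff)
      then show ?thesis by simp
    qed
    have "(\<Sum>n\<in>(+) k ` {n. component A a n \<noteq> 0}. s (component A a (n - k)) y)
        = (\<Sum>n | component A a n \<noteq> 0. s (component A a n) y)"
      by (subst sum.reindex) (auto simp: inj_on_def)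
    then show "s a y = (\<Sum>n\<in>(+) k ` {n. component A a n \<noteq> 0}. s (component A a (n - k)) y)"
      by (simp add: scale_sum_left[symmetric] A.component_sum)
  qed (use A.component_finite in blast)
  then show ?thesis by simp
qed

subsection \<open>Minimal graded resolutions\<close>

text \<open>The kernel lies in \<open>mF\<close> because a component of a relation is a relation: were a coefficient of \<open>g j\<close> outside \<open>m\<close>,
  its degree 0 component would be a unit. The homogeneous parts \<open>\<Gamma> n\<close> and the component maps \<open>\<pi>\<close> are parameters since
  the lemma is applied to graded modules and to twisted free modules, and the latter are proper subsets of
  their type.\<close>

lemma graded_minimal_cover:
  fixes s :: "'r \<Rightarrow> 'm::ab_group_add \<Rightarrow> 'm"
  assumes s: "module s" and T: "finite T" "module.span s T = K"
    and \<Gamma>: "\<And>n. 0 \<in> \<Gamma> n" "\<And>n x y. x \<in> \<Gamma> n \<Longrightarrow> y \<in> \<Gamma> n \<Longrightarrow> x + y \<in> \<Gamma> n"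
      "\<And>i n a x. a \<in> A i \<Longrightarrow> x \<in> \<Gamma> n \<Longrightarrow> s a x \<in> \<Gamma> (i + n)"
    and \<pi>: "\<And>x n. x \<in> K \<Longrightarrow> \<pi> x n \<in> K" "\<And>x n. x \<in> K \<Longrightarrow> \<pi> x n \<in> \<Gamma> n"
      "\<And>x. x \<in> K \<Longrightarrow> finite {n. \<pi> x n \<noteq> 0}" "\<And>x. x \<in> K \<Longrightarrow> x = (\<Sum>n | \<pi> x n \<noteq> 0. \<pi> x n)"
      "\<And>n. \<pi> 0 n = 0" "\<And>x y n. \<pi> (x + y) n = \<pi> x n + \<pi> y n"
      "\<And>a y k n. y \<in> \<Gamma> k \<Longrightarrow> \<pi> (s a y) n = s (component A a (n - k)) y"
  obtains r t f where "module_hom vscale s f" "f ` free_mod r = K"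
    "{x \<in> free_mod r. f x = 0} \<subseteq> ideal_free M r"
    "\<And>x n. x \<in> free_mod r \<Longrightarrow> f x = 0 \<Longrightarrow> f (free_component t x n) = 0"
    "degree_preserving (free_grading A r t) \<Gamma> f"
proof -
  interpret module s by fact
  define H where "H = {y. \<exists>n. y \<in> \<Gamma> n}"
  let ?S = "\<Union>x\<in>T. \<pi> x ` {n. \<pi> x n \<noteq> 0}"
  have TK: "T \<subseteq> K" using T(2) span_superset by blast
  have fin: "finite ?S" using T(1) TK \<pi>(3) by blast
  have SH: "?S \<subseteq> H" using TK \<pi>(2) by (auto simp: H_def)
  have span_S: "span ?S = K"
  proof
    have "?S \<subseteq> K" using TK \<pi>(1) by blast
    then show "span ?S \<subseteq> K" using span_minimal T(2) subspace_span by blast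
    have "x \<in> span ?S" if x: "x \<in> T" for x
    proof -
      have "(\<Sum>n | \<pi> x n \<noteq> 0. \<pi> x n) \<in> span ?S"
        using x by (intro span_sum span_base) blast
      then show ?thesis using \<pi>(4)[of x] x TK by auto
    qed
    then show "K \<subseteq> span ?S" using T(2) span_minimal[of T "span ?S"] by blast
  qed
  obtain r :: nat and g where g: "g ` {..<r} \<subseteq> H" "span (g ` {..<r}) = K"
      "\<And>x j c. (\<Sum>l<r. s (x l) (g l)) = 0 \<Longrightarrow> j < r \<Longrightarrow> c * x j \<noteq> 1"
    by (rule irredundant_generators[OF s fin SH span_S]) blast
  have "\<forall>j. \<exists>n. j < r \<longrightarrow> g j \<in> \<Gamma> n" using g(1) by (auto simp: H_def)
  then obtain t where t: "\<And>j. j < r \<Longrightarrow> g j \<in> \<Gamma> (t j)" by metis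
  have \<pi>_sum: "\<pi> (\<Sum>l<k. h l) n = (\<Sum>l<k. \<pi> (h l) n)" for k :: nat and h n
    by (induction k) (simp_all add: \<pi>(5,6))
  have comp: "\<pi> (lin_comb s r g x) n = lin_comb s r g (free_component t x n)" for x n
    unfolding lin_comb_def \<pi>_sum using \<pi>(7)[OF t] by (intro sum.cong) (auto simp: free_component_def)
  show thesis
  proof
    show "module_hom vscale s (lin_comb s r g)" by (rule module_hom_lin_comb[OF s])
    show "lin_comb s r g ` free_mod r = K" by (simp add: lin_comb_image[OF s] g(2))
    show rel: "lin_comb s r g (free_component t x n) = 0" if "x \<in> free_mod r" "lin_comb s r g x = 0" for x n
      using comp[of x n] that(2) by (simp add: \<pi>(5))
    show "{x \<in> free_mod r. lin_comb s r g x = 0} \<subseteq> ideal_free M r"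
    proof safe
      fix x assume x: "x \<in> free_mod r" "lin_comb s r g x = 0"
      have "x j \<in> M" for j
      proof (cases "j < r")
        case True
        show ?thesis
        proof (rule irrelevant_idealI, rule ccontr)
          assume "component A (x j) 0 \<noteq> 0"
          then obtain c where "component A (x j) 0 * c = 1"
            using A_unit[OF A.component_in] by blast
          \<comment> \<open>The part of the relation of the degree of \<open>g j\<close> has this unit as its \<open>j\<close>-th coefficient.\<close>
          then have "c * free_component t x (t j) j = 1"
            by (simp add: free_component_def mult.commute)
          then show False
            using g(3)[OF rel[OF x, of "t j", unfolded lin_comb_def] True] by blast
        qed
      next
        case False
        then show ?thesis
          using x(1) ring.subspace_0[OF irrelevant_ideal_ideal] by (simp add: free_mod_def)
      qed
      then show "x \<in> ideal_free M r" using x(1) by (simp add: ideal_free_def)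
    qed
    show "degree_preserving (free_grading A r t) \<Gamma> (lin_comb s r g)"
      unfolding degree_preserving_def
    proof (intro allI image_subsetI)
      fix n x assume x: "x \<in> free_grading A r t n"
      have "s (x j) (g j) \<in> \<Gamma> n" if "j < r" for j
        using \<Gamma>(3)[OF _ t[OF that], of "x j" "n - t j"] x that by (simp add: free_grading_def)
      then have "(\<Sum>j<k. s (x j) (g j)) \<in> \<Gamma> n" if "k \<le> r" for k
        using that by (induction k) (auto intro: \<Gamma>)
      then show "lin_comb s r g x \<in> \<Gamma> n" by (simp add: lin_comb_def)
    qed
  qed
qed

lemma free_component_in: "x \<in> free_mod b \<Longrightarrow> free_component t x n \<in> free_grading A b t n"
  by (auto simp: free_component_def free_grading_def free_mod_def A.component_in)

lemma free_component_finite: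
  assumes "x \<in> free_mod b" shows "finite {n. free_component t x n \<noteq> 0}"
proof (rule finite_subset)
  show "{n. free_component t x n \<noteq> 0} \<subseteq> (\<Union>j<b. (+) (t j) ` {n. component A (x j) n \<noteq> 0})"
  proof
    fix n assume "n \<in> {n. free_component t x n \<noteq> 0}"
    then obtain j where j: "component A (x j) (n - t j) \<noteq> 0" by (auto simp: free_component_def fun_eq_iff)
    then have "j < b" using assms by (auto simp: free_mod_def not_less[symmetric])
    moreover have "n \<in> (+) (t j) ` {n. component A (x j) n \<noteq> 0}"
      using j by (intro image_eqI[of _ _ "n - t j"]) auto
    ultimately show "n \<in> (\<Union>j<b. (+) (t j) ` {n. component A (x j) n \<noteq> 0})" by blast
  qed
  show "finite (\<Union>j<b. (+) (t j) ` {n. component A (x j) n \<noteq> 0})"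
    using A.component_finite by blast
qed

lemma free_component_sum:
  assumes "x \<in> free_mod b"
  shows "x = (\<Sum>n | free_component t x n \<noteq> 0. free_component t x n)"
proof
  fix j
  let ?S = "{n. free_component t x n \<noteq> 0}"
  have "{n. component A (x j) n \<noteq> 0} \<subseteq> (\<lambda>n. n - t j) ` ?S"
  proof
    fix n assume "n \<in> {n. component A (x j) n \<noteq> 0}"
    then have "free_component t x (n + t j) j \<noteq> 0" by (simp add: free_component_def)
    then have "free_component t x (n + t j) \<noteq> 0" by (metis zero_fun_apply)
    then show "n \<in> (\<lambda>n. n - t j) ` ?S" by (intro image_eqI[of _ _ "n + t j"]) auto
  qed
  then have "x j = (\<Sum>n\<in>(\<lambda>n. n - t j) ` ?S. component A (x j) n)"
    using A.component_sum_superset[of "(\<lambda>n. n - t j) ` ?S" "x j"] free_component_finite[OF assms] by simp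
  also have "\<dots> = (\<Sum>n\<in>?S. free_component t x n j)"
    by (subst sum.reindex) (auto simp: inj_on_def free_component_def)
  finally show "x j = (\<Sum>n\<in>?S. free_component t x n) j" by (simp add: sum_fun_apply)
qed

lemma graded_minimal_resolution:
  fixes s :: "'r \<Rightarrow> 'm::ab_group_add \<Rightarrow> 'm"
  assumes gm: "graded_module A s G" and fg: "finitely_generated s"
  obtains b t d e where "minimal_graded_free_resolution A s G b t d e"
proof -
  interpret module s using gm by (simp add: graded_module_def)
  interpret G: graded_group G using gm by unfold_locales (simp add: graded_module_def)
  obtain T where T: "finite T" "span T = UNIV"
    using fg by (auto simp: finitely_generated_def)
  obtain r t0 e where e: "module_hom vscale s e" "e ` free_mod r = UNIV"
      "{x \<in> free_mod r. e x = 0} \<subseteq> ideal_free M r"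
      "\<And>x n. x \<in> free_mod r \<Longrightarrow> e x = 0 \<Longrightarrow> e (free_component t0 x n) = 0"
      "degree_preserving (free_grading A r t0) G e"
  proof (rule graded_minimal_cover[OF module_axioms T, where \<Gamma> = G and \<pi> = "component G"])
    show "s a x \<in> G (i + n)" if "a \<in> A i" "x \<in> G n" for i n a x
      using gm that by (auto simp: graded_module_def)
    show "component G (s a y) n = s (component A a (n - k)) y" if "y \<in> G k" for a y k n
      by (rule component_smult[OF gm that])
    show "x = (\<Sum>n | component G x n \<noteq> 0. component G x n)" for x
      by (simp add: G.component_sum)
  qed (blast intro: G.G_zero G.G_add G.component_in G.component_finite G.component_zero G.component_add)+
  have ker: "vec.subspace {x \<in> free_mod n. f x = 0}" if "module_hom vscale u f"
    for n :: nat and u :: "'r \<Rightarrow> 'x::ab_group_add \<Rightarrow> 'x" and f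
    using vec.subspace_inter[OF subspace_free_mod module_hom.subspace_kernel[OF that]]
    by (simp add: Collect_conj_eq)
  have fc_free: "free_component t x n \<in> free_mod b" if "x \<in> free_mod b" for t x n b
    using free_component_in[OF that] by (simp add: free_grading_def)
  define good where "good b t K \<longleftrightarrow> vec.subspace K \<and> K \<subseteq> ideal_free M b
      \<and> (\<forall>x\<in>K. \<forall>n. free_component t x n \<in> K)" for b t K
  obtain b t d where bd: "minimal_free_resolution M s b d e" "b 0 = r" "t 0 = t0"
      "\<And>i. degree_preserving (free_grading A (b (Suc i)) (t (Suc i))) (free_grading A (b i) (t i)) (d (Suc i))"
  proof (rule minimal_resolution_exists[where good = good and ?t0.0 = t0
        and linked = "\<lambda>b' t' b t d. degree_preserving (free_grading A b' t') (free_grading A b t) d",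
        OF irrelevant_ideal_ideal e(1,2)])
    show "good r t0 {x \<in> free_mod r. e x = 0}"
      using ker[OF e(1)] e(3,4) fc_free by (auto simp: good_def)
    show "K \<subseteq> ideal_free M b" if "good b t K" for b t K using that by (simp add: good_def)
    fix b :: nat and t :: "nat \<Rightarrow> int" and K :: "(nat \<Rightarrow> 'r) set"
    assume K: "good b t K"
    then have Kb: "K \<subseteq> free_mod b" by (auto simp: good_def ideal_free_def)
    obtain S where S: "finite S" "vec.span S = K"
      using noetherian_free_mod[OF graded_algebra_noetherian _ Kb] K unfolding good_def by blast
    obtain r' t' f where f: "module_hom vscale vscale f" "f ` free_mod r' = K"
        "{x \<in> free_mod r'. f x = 0} \<subseteq> ideal_free M r'"
        "\<And>x n. x \<in> free_mod r' \<Longrightarrow> f x = 0 \<Longrightarrow> f (free_component t' x n) = 0"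
        "degree_preserving (free_grading A r' t') (free_grading A b t) f"
    proof (rule graded_minimal_cover[OF vec.module_axioms S, where \<Gamma> = "free_grading A b t"
          and \<pi> = "free_component t"])
      show "0 \<in> free_grading A b t n" for n
        by (simp add: free_grading_def free_mod_def A.G_zero)
      show "x + y \<in> free_grading A b t n" if "x \<in> free_grading A b t n" "y \<in> free_grading A b t n" for n x y
        using that by (simp add: free_grading_def free_mod_def A.G_add)
      show "vscale a x \<in> free_grading A b t (i + n)" if "a \<in> A i" "x \<in> free_grading A b t n" for i n a x
        using that A_mult[OF that(1)] by (auto simp: free_grading_def free_mod_def vscale_def add_diff_eq[symmetric])
      show "free_component t x n \<in> K" if "x \<in> K" for x n using K that by (simp add: good_def)
      show "free_component t x n \<in> free_grading A b t n" if "x \<in> K" for x n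
        using that Kb free_component_in by blast
      show "finite {n. free_component t x n \<noteq> 0}" if "x \<in> K" for x
        using that Kb free_component_finite by blast
      show "x = (\<Sum>n | free_component t x n \<noteq> 0. free_component t x n)" if "x \<in> K" for x
        using that Kb free_component_sum by blast
      show "free_component t 0 n = 0" for n by (auto simp: free_component_def)
      show "free_component t (x + y) n = free_component t x n + free_component t y n" for x y n
        by (auto simp: free_component_def A.component_add)
      show "free_component t (vscale a y) n = vscale (component A a (n - k)) y"
        if y: "y \<in> free_grading A b t k" for a y k n
      proof
        fix j
        show "free_component t (vscale a y) n j = vscale (component A a (n - k)) y j"
        proof (cases "j < b")
          case True
          then have "y j \<in> A (k - t j)" using y by (simp add: free_grading_def)
          then show ?thesis using component_mult[of "y j" "k - t j" a "n - t j"]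
            by (simp add: free_component_def vscale_def)
        qed (use y in \<open>simp add: free_component_def vscale_def free_grading_def free_mod_def\<close>)
      qed
    qed blast
    have "good r' t' {x \<in> free_mod r'. f x = 0}"
      using ker[OF f(1)] f(3,4) fc_free by (auto simp: good_def)
    then show "\<exists>b' t' d. module_hom vscale vscale d \<and> d ` free_mod b' = K \<and>
        good b' t' {x \<in> free_mod b'. d x = 0} \<and>
        degree_preserving (free_grading A b' t') (free_grading A b t) d"
      using f(1,2,5) by blast
  qed blast
  have "degree_preserving (free_grading A (b i) (t i)) (free_grading A (b (i - 1)) (t (i - 1))) (d i)"
    if "i \<ge> 1" for i
    using that bd(4)[of "i - 1"] by simp
  then have "minimal_graded_free_resolution A s G b t d e"
    using bd(1-3) e(5) by (simp add: minimal_graded_free_resolution_def)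
  then show thesis by (rule that)
qed

end

section \<open>The theorem\<close>

text \<open>Since minimal resolutions exist, the linearity defect is the value obtained from one of them.\<close>

lemma linearity_defect_eq:
  assumes "noetherian_local_ring m" "module s" "finitely_generated s"
  obtains b d e where "min_res m s b d e" "linearity_defect m s = lin_sup m b d"
proof -
  have "maximal_ideal m" using assms(1) unfolding noetherian_local_ring_def by blast
  then have m: "ideal m" unfolding maximal_ideal_def by blast
  obtain b d e where "minimal_free_resolution m s b d e"
    using local_minimal_resolution[OF assms] .
  then have "\<exists>l b d e. minimal_free_resolution m s b d e \<and> l = lin_sup m b d" by blast
  from someI_ex[OF this] obtain b d e where
    "minimal_free_resolution m s b d e" "linearity_defect m s = lin_sup m b d"
    unfolding linearity_defect_def by blast
  then show thesis using that m by (simp add: min_res_def)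
qed

lemma graded_linearity_defect_eq:
  assumes "standard_graded_algebra A" "graded_module A s G" "finitely_generated s"
  obtains b d e where "min_res (irrelevant_ideal A) s b d e"
    "graded_linearity_defect A s G = lin_sup (irrelevant_ideal A) b d"
proof -
  interpret graded_algebra A by unfold_locales (rule assms(1))
  obtain b t d e where "minimal_graded_free_resolution A s G b t d e"
    using graded_minimal_resolution[OF assms(2,3)] .
  then have "\<exists>l b t d e. minimal_graded_free_resolution A s G b t d e \<and> l = lin_sup M b d" by blast
  from someI_ex[OF this] obtain b t d e where
    "minimal_graded_free_resolution A s G b t d e" "graded_linearity_defect A s G = lin_sup M b d"
    unfolding graded_linearity_defect_def by blast
  moreover from this(1) have "min_res M s b d e"
    using irrelevant_ideal_ideal by (simp add: min_res_def minimal_graded_free_resolution_def)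
  ultimately show thesis using that by blast
qed

theorem theorem3p1:
  fixes sM :: "'r::comm_ring_1 \<Rightarrow> 'a::ab_group_add \<Rightarrow> 'a"
    and sP :: "'r \<Rightarrow> 'b::ab_group_add \<Rightarrow> 'b"
    and sN :: "'r \<Rightarrow> 'c::ab_group_add \<Rightarrow> 'c"
    and \<phi> :: "'a \<Rightarrow> 'b" and \<psi> :: "'b \<Rightarrow> 'c"
    and m :: "'r set"
    and A :: "int \<Rightarrow> 'r set"
    and GM :: "int \<Rightarrow> 'a set" and GP :: "int \<Rightarrow> 'b set" and GN :: "int \<Rightarrow> 'c set"
  assumes exact: "short_exact sM sP sN \<phi> \<psi>"
    and fg: "finitely_generated sM" "finitely_generated sP" "finitely_generated sN"
    and nonzero: "(UNIV :: 'a set) \<noteq> {0}" "(UNIV :: 'b set) \<noteq> {0}" "(UNIV :: 'c set) \<noteq> {0}"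
    and cond_ii: "range \<phi> \<inter> ideal_smult sP m UNIV = ideal_smult sP m (range \<phi>)"
  shows
    "(noetherian_local_ring m \<and> koszul_module m sM \<longrightarrow>
        linearity_defect m sP \<le> linearity_defect m sN \<and>
        linearity_defect m sN \<le> max (linearity_defect m sP) 1 \<and>
        (linearity_defect m sP \<ge> 1 \<longrightarrow> linearity_defect m sN = linearity_defect m sP) \<and>
        (linearity_defect m sP = 0 \<longrightarrow> linearity_defect m sN \<le> 1) \<and>
        (linearity_defect m sN = 0 \<longleftrightarrow>
           koszul_module m sP \<and>
           (\<forall>s\<ge>1. range \<phi> \<inter> ideal_smult sP (ideal_power m s) UNIV
                    = ideal_smult sP (ideal_power m s) (range \<phi>))))
     \<and>
     (standard_graded_algebra A \<and> m = irrelevant_ideal A \<and>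
      graded_module A sM GM \<and> graded_module A sP GP \<and> graded_module A sN GN \<and>
      degree_preserving GM GP \<phi> \<and> degree_preserving GP GN \<psi> \<and>
      graded_koszul_module A sM GM \<longrightarrow>
        graded_linearity_defect A sP GP \<le> graded_linearity_defect A sN GN \<and>
        graded_linearity_defect A sN GN \<le> max (graded_linearity_defect A sP GP) 1 \<and>
        (graded_linearity_defect A sP GP \<ge> 1 \<longrightarrow>
           graded_linearity_defect A sN GN = graded_linearity_defect A sP GP) \<and>
        (graded_linearity_defect A sP GP = 0 \<longrightarrow> graded_linearity_defect A sN GN \<le> 1) \<and>
        (graded_linearity_defect A sN GN = 0 \<longleftrightarrow>
           graded_koszul_module A sP GP \<and>
           (\<forall>s\<ge>1. range \<phi> \<inter> ideal_smult sP (ideal_power m s) UNIV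
                    = ideal_smult sP (ideal_power m s) (range \<phi>))))"
proof -
  have mod: "module sM" "module sP" "module sN"
    using exact by (auto simp: short_exact_def module_hom_def)
  \<comment> \<open>Both cases reduce to this: only the source of the minimal resolutions differs.\<close>
  have main: "P \<le> N \<and> N \<le> max P 1 \<and> (P \<ge> 1 \<longrightarrow> N = P) \<and> (P = 0 \<longrightarrow> N \<le> 1) \<and>
      (N = 0 \<longleftrightarrow> P = 0 \<and> (\<forall>s\<ge>1. range \<phi> \<inter> ideal_smult sP (ideal_power m s) UNIV
                    = ideal_smult sP (ideal_power m s) (range \<phi>)))"
    if "min_res m sM bM dM eM" "0 = lin_sup m bM dM" "min_res m sP bP dP eP" "P = lin_sup m bP dP"
      "min_res m sN bN dN eN" "N = lin_sup m bN dN"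
    for P N bM dM eM bP dP eP bN dN eN
  proof -
    note * = lin_sup_of_extension[OF that(1,5,3) exact cond_ii that(2)[symmetric], folded that(4,6)]
    moreover have "N = P" if "P \<ge> 1" using *(1,2) that by (simp add: max_absorb1)
    moreover have "N \<le> 1" if "P = 0" using *(2) that by simp
    ultimately show ?thesis by blast
  qed
  show ?thesis
    unfolding koszul_module_def graded_koszul_module_def
  proof (rule conjI; rule impI; elim conjE)
    assume loc: "noetherian_local_ring m" and M0: "linearity_defect m sM = 0"
    note ld = linearity_defect_eq[OF loc]
    show "linearity_defect m sP \<le> linearity_defect m sN \<and>
        linearity_defect m sN \<le> max (linearity_defect m sP) 1 \<and>
        (linearity_defect m sP \<ge> 1 \<longrightarrow> linearity_defect m sN = linearity_defect m sP) \<and>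
        (linearity_defect m sP = 0 \<longrightarrow> linearity_defect m sN \<le> 1) \<and>
        (linearity_defect m sN = 0 \<longleftrightarrow> linearity_defect m sP = 0 \<and>
           (\<forall>s\<ge>1. range \<phi> \<inter> ideal_smult sP (ideal_power m s) UNIV
                    = ideal_smult sP (ideal_power m s) (range \<phi>)))"
      by (rule ld[OF mod(1) fg(1)], rule ld[OF mod(2) fg(2)], rule ld[OF mod(3) fg(3)])
         (rule main, (assumption | simp add: M0[symmetric])+)
  next
    assume A: "standard_graded_algebra A" and m: "m = irrelevant_ideal A"
      and gr: "graded_module A sM GM" "graded_module A sP GP" "graded_module A sN GN"
      and M0: "graded_linearity_defect A sM GM = 0"
    note ld = graded_linearity_defect_eq[OF A, folded m]
    show "graded_linearity_defect A sP GP \<le> graded_linearity_defect A sN GN \<and>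
        graded_linearity_defect A sN GN \<le> max (graded_linearity_defect A sP GP) 1 \<and>
        (graded_linearity_defect A sP GP \<ge> 1 \<longrightarrow>
           graded_linearity_defect A sN GN = graded_linearity_defect A sP GP) \<and>
        (graded_linearity_defect A sP GP = 0 \<longrightarrow> graded_linearity_defect A sN GN \<le> 1) \<and>
        (graded_linearity_defect A sN GN = 0 \<longleftrightarrow> graded_linearity_defect A sP GP = 0 \<and>
           (\<forall>s\<ge>1. range \<phi> \<inter> ideal_smult sP (ideal_power m s) UNIV
                    = ideal_smult sP (ideal_power m s) (range \<phi>)))"
      by (rule ld[OF gr(1) fg(1)], rule ld[OF gr(2) fg(2)], rule ld[OF gr(3) fg(3)])
         (rule main, (assumption | simp add: M0[symmetric])+)
  qed
qed

end
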